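(* Let $r\in\mathbb N$, $B>0$ and $\Psi=\{\psi_1,\ldots,\psi_r\}\subset L^2[0,1]$. For $i\in\mathbb N\cup\{0\}$ let $\Psi_i\in\mathbb C^r$ be the vector whose $j$-th coordinate is $\langle\psi_j,L_i^{(0)}\rangle$, where $\{L_i^{(0)}\}$ is the Haar orthonormal basis of $L^2[0,1]$. Define $\mathfrak h_l\in H^+(\partial\mathbb D;\mathbb C^r)$, $l\ge 0$, by $$\mathfrak h_0(\omega)=\sum_{k=0}^\infty\omega^k\,\Psi_{2^k},\qquad \mathfrak h_l(\omega)=\sum_{k=0}^\infty\omega^k\,\Psi_{2^{p+k+1}+l}\quad\Big(l\ge1,\ l=2^p+\sum_{t=0}^{p-1}l_t2^t\Big).$$ Then the wavelet system $X_\Psi$ generated by $\Psi$ is a tight frame for $L^2(\mathbb R)$ with frame bound $B$ if and only if $$\Psi_0=0\in\mathbb C^r$$ and $$\langle\omega^m\mathfrak h_{l'}(\omega),\omega^n\mathfrak h_l(\omega)\rangle_{H^+(\partial\mathbb D;\mathbb C^r)}=\delta_{m-n}\,\beta_{l,l'}\qquad(l,l',m,n\in\mathbb N\cup\{0\}),$$ where - $\beta_{0,0}=B$; - $\beta_{l,l'}=0$ if exactly one of $l,l'$ is $0$; - $\displaystyle\beta_{l,l}=B-\sum_{k=-p}^{0}\big\|\Psi_{2^{p+k}+\sum_{t=0}^{p+k-1}l_t2^t}\big\|^2_{\mathbb C^r}$ if $l\ge1$, $l=2^p+\sum_{t=0}^{p-1}l_t2^t$; - $\displaystyle\beta_{l,l'}=-\sum_{k=\sup\{-p,-p'\}}^{0}\delta_{(\sum_{t=0}^{-k}l_{p+k+t}2^t)-(\sum_{t=0}^{-k}l'_{p'+k+t}2^t)}\,\big\langle\Psi_{2^{p'+k}+\sum_{t=0}^{p'+k-1}l'_t2^t},\Psi_{2^{p+k}+\sum_{t=0}^{p+k-1}l_t2^t}\big\rangle_{\mathbb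 C^r}$ if $l,l'\ge1$, $l\ne l'$, $l=2^p+\sum_{t=0}^{p-1}l_t2^t$, $l'=2^{p'}+\sum_{t=0}^{p'-1}l'_t2^t$.
   Context: Wavelet systems: let $[Tf](x)=f(x-1)$ and $[Df](x)=2^{1/2}f(2x)$ on $L^2(\mathbb R)$. For $\Psi\subset L^2(\mathbb R)$, $X_\Psi=\{D^kT^j\psi:\psi\in\Psi,\ k,j\in\mathbb Z\}$; it is a tight frame with frame bound $B>0$ if $\sum_{\psi\in\Psi}\sum_{k,j\in\mathbb Z}|\langle f,D^kT^j\psi\rangle|^2=B\|f\|^2$ for all $f\in L^2(\mathbb R)$. $L^2[0,1]$ is viewed as the subspace of $L^2(\mathbb R)$ of functions supported in $[0,1]$. Haar basis of $L^2[0,1]$: $L_0^{(0)}=\chi_{[0,1)}$ and $L_{2^p+q}^{(0)}(x)=2^{p/2}\psi^H(2^px-q)$ for $p\ge0$, $0\le q\le 2^p-1$, with $\psi^H=\chi_{[0,1/2)}-\chi_{[1/2,1)}$. $\partial\mathbb D$ is the unit circle; $H^+(\partial\mathbb D;\mathbb C^r)$ is the Hardy space of functions $\sum_{k\ge0}\omega^kh_k$ with $h_k\in\mathbb C^r$, $\sum\|h_k\|^2<\infty$, a closed subspace of $L^2(\partial\mathbb D;\mathbb C^r)$ with normalized measure, so $\langle\sum\omega^kf_k,\sum\omega^kg_k\rangle=\sum_k\langle f_k,g_k\rangle_{\mathbb C^r}$. Inner products are linear in the first argument. $\delta_n=1$ if $n=0$ and $0$ otherwise. In binary expansions $l=2^p+\sum_{t=0}^{p-1}l_t2^t$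 one has $p\ge0$, $l_t\in\{0,1\}$, and $l_p:=1$ (similarly $l'_{p'}:=1$); empty sums are $0$. *)

theory Defs
  imports "HOL-Analysis.Analysis" "HOL-Library.Discrete_Functions"
begin

section \<open>Square-integrable functions\<close>

text \<open>
  Elements of \<open>L\<^sup>2\<close> are handled through representatives: functions that are measurable and
  square-integrable. Everything below depends only on their classes modulo null sets, and over
  \<open>lborel\<close> every class of Lebesgue square-integrable functions has a Borel representative.
\<close>

definition L2 :: "'a measure \<Rightarrow> ('a \<Rightarrow> 'b::{real_normed_vector, second_countable_topology}) set" where
  "L2 M = {f \<in> borel_measurable M. integrable M (\<lambda>x. (norm (f x))\<^sup>2)}"

definition L2_normsq ::
    "'a measure \<Rightarrow> ('a \<Rightarrow> 'b::{real_normed_vector, second_countable_topology}) \<Rightarrow> real" where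
  "L2_normsq M f = (LINT x|M. (norm (f x))\<^sup>2)"

definition L2R_inner :: "(real \<Rightarrow> complex) \<Rightarrow> (real \<Rightarrow> complex) \<Rightarrow> complex" where
  "L2R_inner f g = (LINT x|lborel. f x * cnj (g x))"

definition L2_unit :: "(real \<Rightarrow> complex) set" where
  "L2_unit = {f \<in> L2 lborel. AE x in lborel. x \<notin> {0..1} \<longrightarrow> f x = 0}"

section \<open>Wavelet systems\<close>

definition translation :: "(real \<Rightarrow> complex) \<Rightarrow> real \<Rightarrow> complex" where
  "translation f = (\<lambda>x. f (x - 1))"

definition dilation :: "(real \<Rightarrow> complex) \<Rightarrow> real \<Rightarrow> complex" where
  "dilation f = (\<lambda>x. complex_of_real (sqrt 2) * f (2 * x))"

text \<open>Integer powers of an invertible operator.\<close>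

definition zpow :: "('a \<Rightarrow> 'a) \<Rightarrow> int \<Rightarrow> 'a \<Rightarrow> 'a" where
  "zpow F k = (if 0 \<le> k then F ^^ nat k else (inv F) ^^ nat (- k))"

text \<open>
  The generators form a family \<open>\<psi>\<close> indexed by a finite type, whose cardinality is the \<open>r\<close> of
  \<open>\<complex>\<^sup>r\<close>; repeated generators are counted with multiplicity.
\<close>

definition tight_frame :: "('r::finite \<Rightarrow> real \<Rightarrow> complex) \<Rightarrow> real \<Rightarrow> bool" where
  "tight_frame \<psi> B \<longleftrightarrow>
     (\<forall>f \<in> L2 lborel.
        ((\<lambda>(i, k, j). (cmod (L2R_inner f (zpow dilation k (zpow translation j (\<psi> i)))))\<^sup>2)
           has_sum (B * L2_normsq lborel f)) (UNIV :: ('r \<times> int \<times> int) set))"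

lemma translation_zpow: "zpow translation j f = (\<lambda>x. f (x - of_int j))"
proof -
  have b: "inv translation = (\<lambda>f x. f (x + 1))"
    by (rule inv_equality) (auto simp: translation_def)
  have p: "(translation ^^ n) f = (\<lambda>x. f (x - of_nat n))" for n
    by (induction n) (auto simp: translation_def algebra_simps)
  have q: "((\<lambda>f x. f (x + 1)) ^^ n) f = (\<lambda>x. f (x + of_nat n))" for n
    by (induction n) (auto simp: algebra_simps)
  show ?thesis
    by (auto simp: zpow_def b p q)
qed

lemma dilation_zpow:
  "zpow dilation k f = (\<lambda>x. complex_of_real (2 powr (of_int k / 2)) * f (2 powr of_int k * x))"
proof -
  have b: "inv dilation = (\<lambda>f x. complex_of_real (1 / sqrt 2) * f (x / 2))"
    by (rule inv_equality) (auto simp: dilation_def fun_eq_iff simp flip: of_real_mult)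
  have s: "sqrt 2 = (2::real) powr (1 / 2)"
    by (simp add: powr_half_sqrt)
  have p: "(dilation ^^ n) f =
      (\<lambda>x. complex_of_real (2 powr (of_nat n / 2)) * f (2 powr of_nat n * x))" for n
    by (induction n)
      (auto simp: dilation_def s powr_add add_divide_distrib algebra_simps simp flip: of_real_mult)
  have q: "((\<lambda>f x. complex_of_real (1 / sqrt 2) * f (x / 2)) ^^ n) f =
      (\<lambda>x. complex_of_real (2 powr (- of_nat n / 2)) * f (2 powr (- of_nat n) * x))" for n
  proof (induction n)
    case (Suc n)
    have 1: "1 / sqrt 2 * 2 powr (- of_nat n / 2) = 2 powr (- real (Suc n) / 2)"
      by (simp add: s powr_minus_divide powr_add add_divide_distrib powr_diff diff_divide_distrib)
    have 2: "2 powr (- real n) * (x / 2) = 2 powr (- real (Suc n)) * x" for x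
      by (simp add: powr_diff powr_minus_divide)
    show ?case
      by (simp only: funpow.simps o_def Suc.IH 1[symmetric] 2[symmetric] of_real_mult mult.assoc)
  qed simp
  show ?thesis
  proof (cases "0 \<le> k")
    case True
    then show ?thesis by (simp add: zpow_def p)
  next
    case False
    then show ?thesis using q[of "nat (- k)"] by (simp add: zpow_def b del: of_real_divide)
  qed
qed

section \<open>The Haar basis of \<open>L\<^sup>2[0,1]\<close>\<close>

definition haar_wavelet :: "real \<Rightarrow> complex" where
  "haar_wavelet x = indicator {0..<1/2} x - indicator {1/2..<1} x"

text \<open>For \<open>i = 2 ^ p + q\<close> with \<open>q < 2 ^ p\<close>, the discrete logarithm of \<open>i\<close> is \<open>p\<close>.\<close>

definition haar :: "nat \<Rightarrow> real \<Rightarrow> complex" where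
  "haar i x =
     (if i = 0 then indicator {0..<1} x
      else let p = floor_log i; q = i - 2 ^ p in
        complex_of_real (2 powr (real p / 2)) * haar_wavelet (2 ^ p * x - real q))"

lemma haar_dyadic:
  assumes "q < 2 ^ p"
  shows "haar (2 ^ p + q) x =
    complex_of_real (2 powr (real p / 2)) * haar_wavelet (2 ^ p * x - real q)"
proof -
  have "floor_log (2 ^ p + q) = p"
    using assms by (intro floor_log_eqI) auto
  then show ?thesis
    by (simp add: haar_def Let_def)
qed

definition haar_vec :: "('r::finite \<Rightarrow> real \<Rightarrow> complex) \<Rightarrow> nat \<Rightarrow> complex ^ 'r" where
  "haar_vec \<psi> i = (\<chi> j. L2R_inner (\<psi> j) (haar i))"

section \<open>The Hardy space \<open>H\<^sup>+(\<partial>\<D>; \<complex>\<^sup>r)\<close>\<close>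

text \<open>The library's inner product on \<open>\<complex>\<^sup>r\<close> is the real one, hence the separate definition.\<close>

definition vec_inner :: "complex ^ 'r::finite \<Rightarrow> complex ^ 'r \<Rightarrow> complex" where
  "vec_inner u v = (\<Sum>j\<in>UNIV. u $ j * cnj (v $ j))"

text \<open>
  Normalized arc length, as a measure on the complex plane that is concentrated on the unit circle.
\<close>

definition circle_measure :: "complex measure" where
  "circle_measure = distr (uniform_measure lborel {0..2 * pi}) borel cis"

text \<open>\<open>h(\<omega>) = \<Sum>\<^sub>k \<omega>\<^sup>k c\<^sub>k\<close>, the series converging in \<open>L\<^sup>2(\<partial>\<D>; \<complex>\<^sup>r)\<close>.\<close>

definition hardy_series :: "(nat \<Rightarrow> complex ^ 'r::finite) \<Rightarrow> (complex \<Rightarrow> complex ^ 'r) \<Rightarrow> bool" where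
  "hardy_series c h \<longleftrightarrow>
     h \<in> L2 circle_measure \<and>
     (\<lambda>N. L2_normsq circle_measure (\<lambda>\<omega>. h \<omega> - (\<Sum>k<N. \<omega> ^ k *s c k))) \<longlonglongrightarrow> 0"

definition hardy_space :: "(complex \<Rightarrow> complex ^ 'r::finite) set" where
  "hardy_space = {h. \<exists>c. summable (\<lambda>k. (norm (c k))\<^sup>2) \<and> hardy_series c h}"

text \<open>The inner product of \<open>H\<^sup>+\<close> is inherited from \<open>L\<^sup>2(\<partial>\<D>; \<complex>\<^sup>r)\<close>.\<close>

definition hardy_inner ::
    "(complex \<Rightarrow> complex ^ 'r::finite) \<Rightarrow> (complex \<Rightarrow> complex ^ 'r) \<Rightarrow> complex" where
  "hardy_inner f g = (LINT \<omega>|circle_measure. vec_inner (f \<omega>) (g \<omega>))"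

text \<open>
  A representative of the element of \<open>H\<^sup>+\<close> with coefficients \<open>c\<close>. For square-summable \<open>c\<close> it exists
  (Riesz-Fischer) and is unique up to null sets; by Bessel's inequality the coefficients of
  \<open>\<hh>\<^sub>l\<close> below are square-summable.
\<close>

definition hardy_sum :: "(nat \<Rightarrow> complex ^ 'r::finite) \<Rightarrow> complex \<Rightarrow> complex ^ 'r" where
  "hardy_sum c = (SOME h. h \<in> hardy_space \<and> hardy_series c h)"

definition hardy_h ::
    "('r::finite \<Rightarrow> real \<Rightarrow> complex) \<Rightarrow> nat \<Rightarrow> complex \<Rightarrow> complex ^ 'r" where
  "hardy_h \<psi> l =
     (if l = 0 then hardy_sum (\<lambda>k. haar_vec \<psi> (2 ^ k))
      else hardy_sum (\<lambda>k. haar_vec \<psi> (2 ^ (floor_log l + k + 1) + l)))"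

section \<open>The numbers \<open>\<beta>\<^sub>l\<^sub>,\<^sub>l\<^sub>'\<close>\<close>

definition delta :: "int \<Rightarrow> complex" where
  "delta n = (if n = 0 then 1 else 0)"

definition digit :: "nat \<Rightarrow> nat \<Rightarrow> nat" where
  "digit l t = of_bool (bit l t)"

text \<open>
  For \<open>l \<ge> 1\<close>, \<open>p = floor_log l\<close> is the position of the leading binary digit, so that
  \<open>digit l p = 1\<close>. The summation index \<open>k\<close> running from \<open>-p\<close> (or \<open>sup {-p, -p'}\<close>) to \<open>0\<close> is
  replaced by \<open>s = -k\<close>, which keeps all indices natural numbers.
\<close>

definition low_index :: "nat \<Rightarrow> nat \<Rightarrow> nat" where
  "low_index l n = 2 ^ n + (\<Sum>t<n. digit l t * 2 ^ t)"

definition high_digits :: "nat \<Rightarrow> nat \<Rightarrow> nat" where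
  "high_digits l s = (\<Sum>t\<le>s. digit l (floor_log l - s + t) * 2 ^ t)"

definition beta :: "('r::finite \<Rightarrow> real \<Rightarrow> complex) \<Rightarrow> real \<Rightarrow> nat \<Rightarrow> nat \<Rightarrow> complex" where
  "beta \<psi> B l l' =
     (let p = floor_log l; p' = floor_log l' in
      if l = 0 \<and> l' = 0 then of_real B
      else if l = 0 \<or> l' = 0 then 0
      else if l = l' then
        of_real (B - (\<Sum>s = 0..p. (norm (haar_vec \<psi> (low_index l (p - s))))\<^sup>2))
      else
        - (\<Sum>s = 0..min p p'.
             delta (int (high_digits l s) - int (high_digits l' s)) *
             vec_inner (haar_vec \<psi> (low_index l' (p' - s))) (haar_vec \<psi> (low_index l (p - s)))))"

end

theory Submission
  imports Defs
begin

text \<open>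
  Write \<open>h\<^sub>K\<^sub>,\<^sub>J = D\<^sup>K T\<^sup>J \<psi>\<^sup>H\<close> for the Haar functions on the line, which form an orthonormal basis of
  \<open>L\<^sup>2(\<real>)\<close> (\<open>orthonormal_haar\<close>, \<open>haar_dense\<close>), and let \<open>\<Psi>\<^sub>m\<close> be the vector of \<open>m\<close>-th Haar coefficients
  of the generators.

  A tight frame forces \<open>\<Psi>\<^sub>0 = 0\<close>: the copies of the generators at level \<open>k \<ge> 0\<close> that live inside
  \<open>[0,1]\<close> contribute \<open>\<parallel>\<Psi>\<^sub>0\<parallel>\<^sup>2\<close> to the frame sum of \<open>\<chi>\<^bsub>[0,1)\<^esub>\<close> for every \<open>k\<close>, and the sum is finite
  (\<open>tight_frame_imp_mean_zero\<close>).

  Once the generators have mean zero, \<open>\<langle>h\<^sub>K\<^sub>,\<^sub>J, D\<^sup>k T\<^sup>j \<psi>\<^sub>i\<rangle>\<close> vanishes unless the dyadic interval of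
  \<open>h\<^sub>K\<^sub>,\<^sub>J\<close> lies in the one with parameters \<open>(k, j)\<close>, that is, \<open>k \<le> K\<close> and \<open>j = J div 2\<^bsup>K-k\<^esup>\<close>. In that
  case it is the conjugate of the \<open>i\<close>-th entry of \<open>\<Psi>\<^sub>m\<close> with \<open>m = 2\<^bsup>K-k\<^esup> + J mod 2\<^bsup>K-k\<^esup>\<close>
  (\<open>haar_wave_inner_wave\<close>). So by polarization and density (\<open>tight_frame_iff_dense\<close>) the tight frame
  property says that for any two Haar functions the sum over all common dyadic ancestors, of all
  levels \<open>k\<close>, of the inner products of the corresponding \<open>\<Psi>\<close>-vectors is \<open>B\<close> or \<open>0\<close> according as the
  two functions are equal or not (\<open>tight_frame_iff_gram\<close>).

  Consider the Haar functions with positions \<open>l, l' \<ge> 0\<close>, at levels equal to the numbers of binary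
  digits of \<open>l\<close> and \<open>l'\<close> minus \<open>n\<close> and \<open>m\<close>. At all sufficiently low levels both have the ancestor with
  position \<open>0\<close>. The vectors met there are the coefficients of \<open>\<hh>\<^sub>l\<close> and \<open>\<hh>\<^sub>l\<^sub>'\<close>, and this part of the
  sum is \<open>\<langle>\<omega>\<^sup>m \<hh>\<^sub>l\<^sub>', \<omega>\<^sup>n \<hh>\<^sub>l\<rangle>\<close> (\<open>gram_eq_hardy_inner_plus\<close>). The finitely many remaining common
  ancestors correspond to common leading parts of the binary expansions of \<open>l\<close> and \<open>l'\<close>. They exist
  only for \<open>m = n\<close>, and their contribution is the sum in the definition of \<open>\<beta>\<^sub>l\<^sub>,\<^sub>l\<^sub>'\<close> (\<open>gram_head\<close>).
  Hence the conditions on the \<open>\<hh>\<^sub>l\<close> are the Gram conditions for these pairs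
  (\<open>gram_eq_iff_hardy_inner_eq\<close>).

  They imply all other Gram conditions. A simultaneous dilation leaves the Gram sum invariant
  (\<open>gram_shift\<close>), which gives all pairs of Haar functions on the right half-line. A translation of
  both functions by \<open>2\<^sup>N\<close> moves any pair to the right half-line and changes only the terms of
  levels \<open>k < - N\<close>, whose contribution tends to \<open>0\<close> by Bessel's inequality
  (\<open>gram_translate_tendsto\<close>).
\<close>

section \<open>Square-integrable functions\<close>

definition L2_seminorm ::
    "'a measure \<Rightarrow> ('a \<Rightarrow> 'b::{real_normed_vector, second_countable_topology}) \<Rightarrow> real" where
  "L2_seminorm M f = sqrt (L2_normsq M f)"

lemma L2_normsq_nonneg: "0 \<le> L2_normsq M f"
  by (simp add: L2_normsq_def)

lemma L2_seminorm_nonneg: "0 \<le> L2_seminorm M f"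
  by (simp add: L2_seminorm_def L2_normsq_nonneg)

lemma L2_seminorm_power2: "(L2_seminorm M f)\<^sup>2 = L2_normsq M f"
  by (simp add: L2_seminorm_def L2_normsq_nonneg)

lemma L2_measurable: "f \<in> L2 M \<Longrightarrow> f \<in> borel_measurable M"
  by (simp add: L2_def)

lemma L2_integrable: "f \<in> L2 M \<Longrightarrow> integrable M (\<lambda>x. (norm (f x))\<^sup>2)"
  by (simp add: L2_def)

lemma L2_dominated:
  fixes f :: "'a \<Rightarrow> 'b::{real_normed_vector, second_countable_topology}"
    and g :: "'a \<Rightarrow> 'c::{real_normed_vector, second_countable_topology}"
  assumes "f \<in> L2 M" "g \<in> borel_measurable M" "AE x in M. norm (g x) \<le> C * norm (f x)"
  shows "g \<in> L2 M"
proof -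
  have "integrable M (\<lambda>x. (norm (g x))\<^sup>2)"
  proof (rule Bochner_Integration.integrable_bound)
    show "integrable M (\<lambda>x. C\<^sup>2 * (norm (f x))\<^sup>2)"
      using L2_integrable[OF assms(1)] by simp
    show "(\<lambda>x. (norm (g x))\<^sup>2) \<in> borel_measurable M"
      using assms(2) by measurable
    show "AE x in M. norm ((norm (g x))\<^sup>2) \<le> norm (C\<^sup>2 * (norm (f x))\<^sup>2)"
      using assms(3)
    proof eventually_elim
      case (elim x)
      then have "(norm (g x))\<^sup>2 \<le> (C * norm (f x))\<^sup>2"
        by (intro power_mono) auto
      then show ?case by (simp add: power_mult_distrib)
    qed
  qed
  with assms(2) show ?thesis by (simp add: L2_def)
qed

lemma L2_integrable_norm_mult:
  fixes f :: "'a \<Rightarrow> 'b::{real_normed_vector, second_countable_topology}"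
    and g :: "'a \<Rightarrow> 'c::{real_normed_vector, second_countable_topology}"
  assumes "f \<in> L2 M" "g \<in> L2 M"
  shows "integrable M (\<lambda>x. norm (f x) * norm (g x))"
proof (rule Bochner_Integration.integrable_bound)
  show "integrable M (\<lambda>x. (norm (f x))\<^sup>2 + (norm (g x))\<^sup>2)"
    using assms by (simp add: L2_integrable)
  show "(\<lambda>x. norm (f x) * norm (g x)) \<in> borel_measurable M"
    using assms[THEN L2_measurable] by measurable
  have "a * b \<le> a\<^sup>2 + b\<^sup>2" for a b :: real
    using sum_squares_bound[of a b] zero_le_power2[of a] zero_le_power2[of b]
    by (cases "0 \<le> a * b") (auto simp: not_le intro: order_trans[of _ 0])
  then show "AE x in M. norm (norm (f x) * norm (g x)) \<le> norm ((norm (f x))\<^sup>2 + (norm (g x))\<^sup>2)"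
    by (simp add: abs_mult)
qed

text \<open>The quadratic polynomial \<open>t \<mapsto> \<integral> (|f| - t |g|)\<^sup>2\<close> is nonnegative.\<close>

lemma L2_Cauchy_Schwarz:
  fixes f :: "'a \<Rightarrow> 'b::{real_normed_vector, second_countable_topology}"
    and g :: "'a \<Rightarrow> 'c::{real_normed_vector, second_countable_topology}"
  assumes "f \<in> L2 M" "g \<in> L2 M"
  shows "(LINT x|M. norm (f x) * norm (g x)) \<le> L2_seminorm M f * L2_seminorm M g"
proof -
  let ?I = "LINT x|M. norm (f x) * norm (g x)"
  note int = L2_integrable[OF assms(1)] L2_integrable[OF assms(2)] L2_integrable_norm_mult[OF assms]
  have "0 \<le> L2_normsq M f + t\<^sup>2 * L2_normsq M g - 2 * t * ?I" for t
  proof -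
    have "0 \<le> (LINT x|M. (norm (f x) - t * norm (g x))\<^sup>2)"
      by simp
    also have "\<dots> = (LINT x|M. (norm (f x))\<^sup>2 + t\<^sup>2 * (norm (g x))\<^sup>2 - 2 * t * (norm (f x) * norm (g x)))"
      by (simp add: power2_diff power_mult_distrib mult_ac)
    also have "\<dots> = L2_normsq M f + t\<^sup>2 * L2_normsq M g - 2 * t * ?I"
      using int by (simp add: L2_normsq_def)
    finally show ?thesis .
  qed
  note quad = this
  have "?I\<^sup>2 \<le> L2_normsq M f * L2_normsq M g"
  proof (cases "L2_normsq M g = 0")
    case True
    have "?I = 0"
    proof (rule ccontr)
      assume "?I \<noteq> 0"
      then show False
        using quad[of "(L2_normsq M f + 1) / (2 * ?I)"] True by simp
    qed
    with True show ?thesis by simp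
  next
    case False
    then have pos: "L2_normsq M g > 0" using L2_normsq_nonneg[of M g] by simp
    then show ?thesis
      using quad[of "?I / L2_normsq M g"]
      by (simp add: field_simps power2_eq_square)
  qed
  then show ?thesis
    unfolding L2_seminorm_def real_sqrt_mult[symmetric] by (rule real_le_rsqrt)
qed

lemma L2_add:
  assumes "f \<in> L2 M" "g \<in> L2 M"
  shows "(\<lambda>x. f x + g x) \<in> L2 M"
proof -
  have "(\<lambda>x. norm (f x) + norm (g x)) \<in> L2 M"
    using assms L2_integrable_norm_mult[OF assms]
    by (auto simp: L2_def power2_sum mult.assoc)
  then show ?thesis
  proof (rule L2_dominated)
    show "(\<lambda>x. f x + g x) \<in> borel_measurable M"
      using assms[THEN L2_measurable] by measurable
    show "AE x in M. norm (f x + g x) \<le> 1 * norm (norm (f x) + norm (g x))"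
      by (simp add: norm_triangle_ineq)
  qed
qed

lemma L2_uminus: "f \<in> L2 M \<Longrightarrow> (\<lambda>x. - f x) \<in> L2 M"
  by (auto simp: L2_def)

lemma L2_diff: "f \<in> L2 M \<Longrightarrow> g \<in> L2 M \<Longrightarrow> (\<lambda>x. f x - g x) \<in> L2 M"
  using L2_add[of f M "\<lambda>x. - g x"] L2_uminus[of g M] by simp

lemma L2_zero: "(\<lambda>x. 0) \<in> L2 M"
  by (simp add: L2_def)

lemma L2_sum: "(\<And>i. i \<in> I \<Longrightarrow> f i \<in> L2 M) \<Longrightarrow> (\<lambda>x. \<Sum>i\<in>I. f i x) \<in> L2 M"
  by (induction I rule: infinite_finite_induct) (auto intro: L2_zero L2_add)

lemma L2_cmult: "f \<in> L2 M \<Longrightarrow> (\<lambda>x. (c::complex) * f x) \<in> L2 M"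
  by (auto simp: L2_def norm_mult power_mult_distrib)

lemma L2_seminorm_triangle:
  assumes "f \<in> L2 M" "g \<in> L2 M"
  shows "L2_seminorm M (\<lambda>x. f x + g x) \<le> L2_seminorm M f + L2_seminorm M g"
proof (rule power2_le_imp_le)
  note int = L2_integrable[OF assms(1)] L2_integrable[OF assms(2)] L2_integrable_norm_mult[OF assms]
  have "(L2_seminorm M (\<lambda>x. f x + g x))\<^sup>2 = (LINT x|M. (norm (f x + g x))\<^sup>2)"
    by (simp add: L2_seminorm_power2 L2_normsq_def)
  also have "\<dots> \<le> (LINT x|M. (norm (f x))\<^sup>2 + (norm (g x))\<^sup>2 + 2 * (norm (f x) * norm (g x)))"
  proof (rule integral_mono)
    show "integrable M (\<lambda>x. (norm (f x + g x))\<^sup>2)"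
      using L2_add[OF assms] by (rule L2_integrable)
    fix x
    show "(norm (f x + g x))\<^sup>2 \<le> (norm (f x))\<^sup>2 + (norm (g x))\<^sup>2 + 2 * (norm (f x) * norm (g x))"
      using power_mono[OF norm_triangle_ineq[of "f x" "g x"], of 2]
      by (simp add: power2_sum mult_ac)
  qed (use int in simp)
  also have "\<dots> = L2_normsq M f + L2_normsq M g + 2 * (LINT x|M. norm (f x) * norm (g x))"
    using int by (simp add: L2_normsq_def)
  also have "\<dots> \<le> (L2_seminorm M f + L2_seminorm M g)\<^sup>2"
    using L2_Cauchy_Schwarz[OF assms] by (simp add: power2_sum L2_seminorm_power2)
  finally show "(L2_seminorm M (\<lambda>x. f x + g x))\<^sup>2 \<le> (L2_seminorm M f + L2_seminorm M g)\<^sup>2" .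
qed (simp add: L2_seminorm_nonneg)

lemma L2_seminorm_commute: "L2_seminorm M (\<lambda>x. f x - g x) = L2_seminorm M (\<lambda>x. g x - f x)"
  by (simp add: L2_seminorm_def L2_normsq_def norm_minus_commute)

lemma L2_seminorm_triangle_diff:
  assumes "f \<in> L2 M" "g \<in> L2 M" "h \<in> L2 M"
  shows "L2_seminorm M (\<lambda>x. f x - h x) \<le> L2_seminorm M (\<lambda>x. f x - g x) + L2_seminorm M (\<lambda>x. g x - h x)"
  using L2_seminorm_triangle[OF L2_diff[OF assms(1,2)] L2_diff[OF assms(2,3)]] by simp

lemma L2_seminorm_diff:
  assumes "f \<in> L2 M" "g \<in> L2 M"
  shows "\<bar>L2_seminorm M f - L2_seminorm M g\<bar> \<le> L2_seminorm M (\<lambda>x. f x - g x)"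
  using L2_seminorm_triangle_diff[OF assms L2_zero] L2_seminorm_triangle_diff[OF assms(2,1) L2_zero]
    L2_seminorm_commute[of M f g] by simp

lemma tendsto_L2_seminorm:
  assumes f: "\<And>n. F n \<in> L2 M" "f \<in> L2 M"
    and lim: "(\<lambda>n. L2_seminorm M (\<lambda>x. f x - F n x)) \<longlonglongrightarrow> 0"
  shows "(\<lambda>n. L2_seminorm M (F n)) \<longlonglongrightarrow> L2_seminorm M f"
proof -
  have "(\<lambda>n. L2_seminorm M (F n) - L2_seminorm M f) \<longlonglongrightarrow> 0"
    using L2_seminorm_diff[OF f] L2_seminorm_commute[of M f]
    by (intro Lim_null_comparison[OF _ lim] always_eventually allI) (simp add: abs_minus_commute)
  then show ?thesis by (simp add: LIM_zero_iff)
qed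

text \<open>
  Real-bilinear maps cover at once the inner products of \<open>\<complex>\<close> and \<open>\<complex>\<^sup>r\<close>, which are conjugate-linear
  in the second argument, and multiplication by scalar functions.
\<close>

lemma L2_borel_measurable_bilinear:
  fixes prod :: "'b::{real_normed_vector, second_countable_topology} \<Rightarrow>
    'c::{real_normed_vector, second_countable_topology} \<Rightarrow> 'd::{banach, second_countable_topology}"
  assumes "bounded_bilinear prod" "f \<in> borel_measurable M" "g \<in> borel_measurable M"
  shows "(\<lambda>x. prod (f x) (g x)) \<in> borel_measurable M"
  using assms(2,3)
  by (rule borel_measurable_continuous_Pair)
     (rule bounded_bilinear.continuous_on[OF assms(1) continuous_on_fst continuous_on_snd];
      rule continuous_on_id)

lemma L2_integrable_bilinear:
  fixes prod :: "'b::{real_normed_vector, second_countable_topology} \<Rightarrow>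
    'c::{real_normed_vector, second_countable_topology} \<Rightarrow> 'd::{banach, second_countable_topology}"
  assumes "bounded_bilinear prod" "f \<in> L2 M" "g \<in> L2 M"
  shows "integrable M (\<lambda>x. prod (f x) (g x))"
proof -
  obtain K where K: "\<And>a b. norm (prod a b) \<le> norm a * norm b * K"
    using bounded_bilinear.bounded[OF assms(1)] by blast
  show ?thesis
  proof (rule Bochner_Integration.integrable_bound)
    show "integrable M (\<lambda>x. norm (f x) * norm (g x) * K)"
      using L2_integrable_norm_mult[OF assms(2,3)] by simp
    show "AE x in M. norm (prod (f x) (g x)) \<le> norm (norm (f x) * norm (g x) * K)"
      using order_trans[OF K abs_ge_self] by simp
  qed (use assms in \<open>auto intro: L2_borel_measurable_bilinear L2_measurable\<close>)
qed

lemma L2_bilinear_bound: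
  fixes prod :: "'b::{real_normed_vector, second_countable_topology} \<Rightarrow>
    'c::{real_normed_vector, second_countable_topology} \<Rightarrow> 'd::{banach, second_countable_topology}"
  assumes "bounded_bilinear prod"
  obtains K where "K \<ge> 0" and "\<And>f g. f \<in> L2 M \<Longrightarrow> g \<in> L2 M \<Longrightarrow>
    norm (LINT x|M. prod (f x) (g x)) \<le> K * (L2_seminorm M f * L2_seminorm M g)"
proof -
  obtain K where K: "K \<ge> 0" "\<And>a b. norm (prod a b) \<le> norm a * norm b * K"
    using bounded_bilinear.nonneg_bounded[OF assms(1)] by blast
  show ?thesis
  proof (rule that[OF K(1)])
    fix f :: "'a \<Rightarrow> 'b" and g :: "'a \<Rightarrow> 'c" assume fg: "f \<in> L2 M" "g \<in> L2 M"
    have "norm (LINT x|M. prod (f x) (g x)) \<le> (LINT x|M. norm (prod (f x) (g x)))"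
      by (rule integral_norm_bound)
    also have "\<dots> \<le> (LINT x|M. norm (f x) * norm (g x) * K)"
      using K(2) L2_integrable_norm_mult[OF fg] L2_integrable_bilinear[OF assms fg]
      by (intro integral_mono) auto
    also have "\<dots> = K * (LINT x|M. norm (f x) * norm (g x))"
      by simp
    also have "\<dots> \<le> K * (L2_seminorm M f * L2_seminorm M g)"
      using L2_Cauchy_Schwarz[OF fg] K(1) by (rule mult_left_mono)
    finally show "norm (LINT x|M. prod (f x) (g x)) \<le> K * (L2_seminorm M f * L2_seminorm M g)" .
  qed
qed

lemma tendsto_L2_bilinear:
  fixes prod :: "'b::{real_normed_vector, second_countable_topology} \<Rightarrow>
    'c::{real_normed_vector, second_countable_topology} \<Rightarrow> 'd::{banach, second_countable_topology}"
  assumes prod: "bounded_bilinear prod"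
    and F: "\<And>n. F n \<in> L2 M" and f: "f \<in> L2 M"
    and F_lim: "(\<lambda>n. L2_seminorm M (\<lambda>x. f x - F n x)) \<longlonglongrightarrow> 0"
    and G: "\<And>n. G n \<in> L2 M" and g: "g \<in> L2 M"
    and G_lim: "(\<lambda>n. L2_seminorm M (\<lambda>x. g x - G n x)) \<longlonglongrightarrow> 0"
  shows "(\<lambda>n. LINT x|M. prod (F n x) (G n x)) \<longlonglongrightarrow> (LINT x|M. prod (f x) (g x))"
proof -
  interpret prod: bounded_bilinear prod by fact
  obtain K where K: "K \<ge> 0" "\<And>f g. f \<in> L2 M \<Longrightarrow> g \<in> L2 M \<Longrightarrow>
      norm (LINT x|M. prod (f x) (g x)) \<le> K * (L2_seminorm M f * L2_seminorm M g)"
    using L2_bilinear_bound[OF prod] by blast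
  let ?D = "\<lambda>n. K * (L2_seminorm M (\<lambda>x. f x - F n x) * L2_seminorm M (G n)) +
    K * (L2_seminorm M f * L2_seminorm M (\<lambda>x. g x - G n x))"
  have bound: "norm ((LINT x|M. prod (F n x) (G n x)) - (LINT x|M. prod (f x) (g x))) \<le> ?D n" for n
  proof -
    note int = L2_integrable_bilinear[OF prod]
    have "(LINT x|M. prod (f x) (g x)) - (LINT x|M. prod (F n x) (G n x)) =
        (LINT x|M. prod (f x - F n x) (G n x)) + (LINT x|M. prod (f x) (g x - G n x))"
      using int[OF f g] int[OF F[of n] G[of n]] int[OF f G[of n]]
      by (simp add: prod.diff_left prod.diff_right)
    also have "norm \<dots> \<le> ?D n"
      using K(2)[OF L2_diff[OF f F[of n]] G[of n]] K(2)[OF f L2_diff[OF g G[of n]]]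
      by (rule norm_triangle_mono)
    finally show ?thesis by (simp add: norm_minus_commute)
  qed
  have "?D \<longlonglongrightarrow> K * (0 * L2_seminorm M g) + K * (L2_seminorm M f * 0)"
    by (intro tendsto_intros F_lim G_lim tendsto_L2_seminorm[OF G g])
  then have "?D \<longlonglongrightarrow> 0" by simp
  then have "(\<lambda>n. (LINT x|M. prod (F n x) (G n x)) - (LINT x|M. prod (f x) (g x))) \<longlonglongrightarrow> 0"
    using bound by (rule Lim_null_comparison[OF always_eventually[OF allI], rotated])
  then show ?thesis by (simp add: LIM_zero_iff)
qed

text \<open>
  Along a subsequence with increments \<open>d\<^sub>k\<close> of norm at most \<open>4\<^sup>-\<^sup>k\<close>, the sum \<open>\<Sum>\<^sub>k 4\<^sup>k |d\<^sub>k(x)|\<^sup>2\<close> has a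
  finite integral and so is finite for almost every \<open>x\<close>. There \<open>|d\<^sub>k(x)|\<close> decays geometrically and
  the subsequence converges; Fatou's lemma shows that the limit is also the limit in \<open>L\<^sup>2\<close>.
\<close>

lemma L2_complete:
  fixes s :: "nat \<Rightarrow> 'a \<Rightarrow> 'b::{banach, second_countable_topology}"
  assumes s: "\<And>n. s n \<in> L2 M"
    and Cauchy: "\<And>e. e > 0 \<Longrightarrow> \<exists>N. \<forall>m\<ge>N. \<forall>n\<ge>N. L2_seminorm M (\<lambda>x. s m x - s n x) \<le> e"
  shows "\<exists>u\<in>L2 M. (\<lambda>n. L2_seminorm M (\<lambda>x. u x - s n x)) \<longlonglongrightarrow> 0"
proof -
  have [measurable]: "s n \<in> borel_measurable M" for n
    using s by (rule L2_measurable)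
  have "\<forall>k. \<exists>N. \<forall>m\<ge>N. \<forall>n\<ge>N. L2_seminorm M (\<lambda>x. s m x - s n x) \<le> (1/4) ^ k"
    using Cauchy by simp
  then obtain N where N: "\<And>k m n. m \<ge> N k \<Longrightarrow> n \<ge> N k \<Longrightarrow>
      L2_seminorm M (\<lambda>x. s m x - s n x) \<le> (1/4) ^ k"
    by metis
  (* The sum makes r increasing with r k >= N k, the summand k makes it tend to infinity. *)
  define r where "r k = (\<Sum>j\<le>k. N j) + k" for k
  have r_ge: "r k \<ge> N k" "r k \<ge> k" for k
    by (auto simp: r_def intro!: trans_le_add1 member_le_sum)
  have r_Suc: "r (Suc k) \<ge> r k" for k
    by (simp add: r_def)
  define d where "d k x = s (r (Suc k)) x - s (r k) x" for k x
  have [measurable]: "d k \<in> borel_measurable M" for k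
    unfolding d_def by measurable
  have d_L2: "d k \<in> L2 M" for k
    unfolding d_def using s by (intro L2_diff)
  have d_norm: "L2_normsq M (d k) \<le> (1/16) ^ k" for k
  proof -
    have "L2_seminorm M (d k) \<le> (1/4) ^ k"
      unfolding d_def by (intro N) (use r_ge r_Suc order_trans in blast)+
    then have "(L2_seminorm M (d k))\<^sup>2 \<le> ((1/4) ^ k)\<^sup>2"
      using L2_seminorm_nonneg by (intro power_mono)
    also have "((1/4) ^ k)\<^sup>2 = (1/16::real) ^ k"
      by (simp add: power2_eq_square flip: power_mult_distrib)
    finally show ?thesis by (simp add: L2_seminorm_power2)
  qed
  have conv: "AE x in M. convergent (\<lambda>k. s (r k) x)"
  proof -
    let ?G = "\<lambda>x. \<Sum>k. ennreal (4 ^ k * (norm (d k x))\<^sup>2)"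
    have "(\<integral>\<^sup>+x. ?G x \<partial>M) = (\<Sum>k. \<integral>\<^sup>+x. ennreal (4 ^ k * (norm (d k x))\<^sup>2) \<partial>M)"
      by (rule nn_integral_suminf) measurable
    also have "\<dots> = (\<Sum>k. ennreal (4 ^ k * L2_normsq M (d k)))"
      unfolding L2_normsq_def
      by (subst nn_integral_eq_integral) (use L2_integrable[OF d_L2] in auto)
    also have "\<dots> \<le> (\<Sum>k. ennreal ((1/4) ^ k))"
    proof (intro suminf_le ennreal_leI)
      fix k
      have "4 ^ k * L2_normsq M (d k) \<le> 4 ^ k * (1/16) ^ k"
        using d_norm by (intro mult_left_mono) auto
      also have "\<dots> = (1/4) ^ k" by (simp flip: power_mult_distrib)
      finally show "4 ^ k * L2_normsq M (d k) \<le> (1/4) ^ k" .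
    qed auto
    also have "\<dots> = ennreal (\<Sum>k. (1/4) ^ k)"
      by (rule suminf_ennreal2) (auto intro: summable_geometric)
    finally have "(\<integral>\<^sup>+x. ?G x \<partial>M) \<noteq> \<infinity>"
      unfolding infinity_ennreal_def by (metis ennreal_neq_top top_unique)
    then have "AE x in M. ?G x \<noteq> \<infinity>"
      by (rule nn_integral_noteq_infinite[rotated]) measurable
    then show ?thesis
    proof eventually_elim
      case (elim x)
      define C where "C = enn2real (?G x)"
      have C: "?G x = ennreal C"
        using elim unfolding C_def infinity_ennreal_def less_top by (rule ennreal_enn2real[symmetric])
      have C_nonneg: "C \<ge> 0"
        unfolding C_def by (rule enn2real_nonneg)
      have "norm (d k x) \<le> sqrt C * (1/2) ^ k" for k
      proof (rule power2_le_imp_le)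
        have "(\<Sum>k\<in>{k}. ennreal (4 ^ k * (norm (d k x))\<^sup>2)) \<le> ?G x"
          by (rule sum_le_suminf) auto
        then have "4 ^ k * (norm (d k x))\<^sup>2 \<le> C"
          unfolding C using C_nonneg by simp
        then have "(norm (d k x))\<^sup>2 \<le> C / 4 ^ k"
          by (simp add: field_simps)
        also have "C / 4 ^ k = (sqrt C * (1/2) ^ k)\<^sup>2"
        proof -
          have "((1/2) ^ k)\<^sup>2 = 1 / (4::real) ^ k"
            by (simp add: power2_eq_square power_one_over flip: power_mult_distrib)
          then show ?thesis
            using C_nonneg by (simp add: power_mult_distrib)
        qed
        finally show "(norm (d k x))\<^sup>2 \<le> (sqrt C * (1/2) ^ k)\<^sup>2" .
      qed (use C_nonneg in auto)
      then have "summable (\<lambda>k. d k x)"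
        by (rule summable_comparison_test'[where N = 0, OF summable_mult[OF summable_geometric], rotated]) auto
      then have "convergent (\<lambda>n. \<Sum>k<n. d k x)"
        by (simp add: summable_iff_convergent)
      moreover have "(\<Sum>k<n. d k x) = s (r n) x - s (r 0) x" for n
        by (induction n) (auto simp: d_def)
      ultimately show ?case
        by (simp add: convergent_diff_const_right_iff)
    qed
  qed
  define u where "u x = lim (\<lambda>k. s (r k) x)" for x
  have [measurable]: "u \<in> borel_measurable M"
    unfolding u_def by measurable
  have bound: "integrable M (\<lambda>x. (norm (u x - s m x))\<^sup>2) \<and> L2_seminorm M (\<lambda>x. u x - s m x) \<le> e"
    if "e > 0" and Ne: "\<And>m n. m \<ge> N' \<Longrightarrow> n \<ge> N' \<Longrightarrow> L2_seminorm M (\<lambda>x. s m x - s n x) \<le> e"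
      and "m \<ge> N'" for e N' m
  proof -
    have "(\<integral>\<^sup>+x. ennreal ((norm (u x - s m x))\<^sup>2) \<partial>M)
        = (\<integral>\<^sup>+x. liminf (\<lambda>k. ennreal ((norm (s (r k) x - s m x))\<^sup>2)) \<partial>M)"
    proof (rule nn_integral_cong_AE, use conv in eventually_elim)
      case (elim x)
      then have "(\<lambda>k. s (r k) x) \<longlonglongrightarrow> u x"
        by (simp add: u_def convergent_LIMSEQ_iff)
      then have "(\<lambda>k. ennreal ((norm (s (r k) x - s m x))\<^sup>2)) \<longlonglongrightarrow> ennreal ((norm (u x - s m x))\<^sup>2)"
        by (intro tendsto_intros)
      then show ?case
        by (rule lim_imp_Liminf[symmetric, rotated]) simp
    qed
    also have "\<dots> \<le> liminf (\<lambda>k. \<integral>\<^sup>+x. ennreal ((norm (s (r k) x - s m x))\<^sup>2) \<partial>M)"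
      by (rule nn_integral_liminf) measurable
    also have "\<dots> \<le> liminf (\<lambda>k::nat. ennreal (e\<^sup>2))"
    proof (rule Liminf_mono, use eventually_ge_at_top[of N'] in eventually_elim)
      case (elim k)
      have "(\<integral>\<^sup>+x. ennreal ((norm (s (r k) x - s m x))\<^sup>2) \<partial>M)
          = ennreal ((L2_seminorm M (\<lambda>x. s (r k) x - s m x))\<^sup>2)"
        unfolding L2_seminorm_power2 L2_normsq_def
        using L2_integrable[OF L2_diff[OF s s]] by (intro nn_integral_eq_integral) auto
      also have "\<dots> \<le> ennreal (e\<^sup>2)"
        using Ne[of "r k" m] elim r_ge(2)[of k] that(3)
        by (intro ennreal_leI power_mono L2_seminorm_nonneg) auto
      finally show ?case .
    qed
    also have "\<dots> = ennreal (e\<^sup>2)"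
      by (simp add: Liminf_const)
    finally have le: "(\<integral>\<^sup>+x. ennreal ((norm (u x - s m x))\<^sup>2) \<partial>M) \<le> ennreal (e\<^sup>2)" .
    then have int: "integrable M (\<lambda>x. (norm (u x - s m x))\<^sup>2)"
      by (intro integrableI_bounded) (auto intro: le_less_trans)
    then have "ennreal (L2_normsq M (\<lambda>x. u x - s m x)) \<le> ennreal (e\<^sup>2)"
      unfolding L2_normsq_def using le by (subst nn_integral_eq_integral[symmetric]) auto
    then have "L2_normsq M (\<lambda>x. u x - s m x) \<le> e\<^sup>2"
      by simp
    then have "L2_seminorm M (\<lambda>x. u x - s m x) \<le> e"
      unfolding L2_seminorm_def using \<open>e > 0\<close> by (simp add: real_le_lsqrt)
    with int show ?thesis by simp
  qed
  show ?thesis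
  proof
    obtain N' where "\<And>m n. m \<ge> N' \<Longrightarrow> n \<ge> N' \<Longrightarrow> L2_seminorm M (\<lambda>x. s m x - s n x) \<le> 1"
      using Cauchy[of 1] by auto
    from bound[OF _ this] have "(\<lambda>x. u x - s N' x) \<in> L2 M"
      by (auto simp: L2_def)
    from L2_add[OF this s[of N']] show "u \<in> L2 M" by simp
    show "(\<lambda>n. L2_seminorm M (\<lambda>x. u x - s n x)) \<longlonglongrightarrow> 0"
    proof (rule LIMSEQ_I)
      fix e :: real assume "e > 0"
      then obtain N' where "\<And>m n. m \<ge> N' \<Longrightarrow> n \<ge> N' \<Longrightarrow> L2_seminorm M (\<lambda>x. s m x - s n x) \<le> e/2"
        using Cauchy[of "e/2"] by auto
      then have "norm (L2_seminorm M (\<lambda>x. u x - s n x) - 0) < e" if "n \<ge> N'" for n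
        using bound[of "e/2" N' n] L2_seminorm_nonneg[of M "\<lambda>x. u x - s n x"] \<open>e > 0\<close> that by auto
      then show "\<exists>no. \<forall>n\<ge>no. norm (L2_seminorm M (\<lambda>x. u x - s n x) - 0) < e"
        by blast
    qed
  qed
qed

section \<open>Orthonormal systems and tight frames in \<open>L\<^sup>2(\<real>)\<close>\<close>

lemma bounded_bilinear_cnj_mult: "bounded_bilinear (\<lambda>a b :: complex. a * cnj b)"
  by (rule bounded_bilinear.comp[OF bounded_bilinear_mult bounded_linear_ident bounded_linear_cnj])

lemma L2R_inner_integrable:
  "f \<in> L2 lborel \<Longrightarrow> g \<in> L2 lborel \<Longrightarrow> integrable lborel (\<lambda>x. f x * cnj (g x))"
  by (rule L2_integrable_bilinear[OF bounded_bilinear_cnj_mult])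

lemma L2R_inner_add_left:
  assumes "f \<in> L2 lborel" "g \<in> L2 lborel" "u \<in> L2 lborel"
  shows "L2R_inner (\<lambda>x. f x + g x) u = L2R_inner f u + L2R_inner g u"
  using L2R_inner_integrable[OF assms(1,3)] L2R_inner_integrable[OF assms(2,3)]
  by (simp add: L2R_inner_def ring_distribs)

lemma L2R_inner_diff_left:
  assumes "f \<in> L2 lborel" "g \<in> L2 lborel" "u \<in> L2 lborel"
  shows "L2R_inner (\<lambda>x. f x - g x) u = L2R_inner f u - L2R_inner g u"
  using L2R_inner_integrable[OF assms(1,3)] L2R_inner_integrable[OF assms(2,3)]
  by (simp add: L2R_inner_def ring_distribs)

lemma L2R_inner_cmult_left: "L2R_inner (\<lambda>x. c * f x) u = c * L2R_inner f u"
  by (simp add: L2R_inner_def mult.assoc)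

lemma L2R_inner_commute: "L2R_inner g f = cnj (L2R_inner f g)"
  unfolding L2R_inner_def Bochner_Integration.integral_cnj[symmetric] by (simp add: mult.commute)

lemma cnj_L2R_inner: "cnj (L2R_inner f g) = L2R_inner g f"
  by (rule L2R_inner_commute[symmetric])

lemma L2R_inner_zero_left: "L2R_inner (\<lambda>x. 0) u = 0"
  by (simp add: L2R_inner_def)

lemma L2R_inner_sum_left:
  assumes "\<And>i. i \<in> I \<Longrightarrow> f i \<in> L2 lborel" "u \<in> L2 lborel"
  shows "L2R_inner (\<lambda>x. \<Sum>i\<in>I. c i * f i x) u = (\<Sum>i\<in>I. c i * L2R_inner (f i) u)"
  using assms(1)
proof (induction I rule: infinite_finite_induct)
  case (insert i I)
  then have "L2R_inner (\<lambda>x. c i * f i x + (\<Sum>j\<in>I. c j * f j x)) u =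
      c i * L2R_inner (f i) u + (\<Sum>j\<in>I. c j * L2R_inner (f j) u)"
    using assms(2) by (subst L2R_inner_add_left) (auto intro!: L2_sum L2_cmult simp: L2R_inner_cmult_left)
  with insert show ?case by simp
qed (auto simp: L2R_inner_zero_left)

lemma L2R_inner_sum_right:
  assumes "\<And>i. i \<in> I \<Longrightarrow> f i \<in> L2 lborel" "u \<in> L2 lborel"
  shows "L2R_inner u (\<lambda>x. \<Sum>i\<in>I. c i * f i x) = (\<Sum>i\<in>I. cnj (c i) * L2R_inner u (f i))"
  using L2R_inner_sum_left[OF assms, where c = c, THEN arg_cong[where f = cnj]]
  by (simp add: cnj_L2R_inner)

lemma L2R_inner_self: "L2R_inner f f = of_real (L2_normsq lborel f)"
  unfolding L2R_inner_def L2_normsq_def complex_norm_square[symmetric]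
  by (rule integral_complex_of_real)

lemma tendsto_L2R_inner:
  assumes "\<And>n. F n \<in> L2 lborel" "f \<in> L2 lborel" "u \<in> L2 lborel"
    and "(\<lambda>n. L2_seminorm lborel (\<lambda>x. f x - F n x)) \<longlonglongrightarrow> 0"
  shows "(\<lambda>n. L2R_inner (F n) u) \<longlonglongrightarrow> L2R_inner f u"
  unfolding L2R_inner_def
  by (rule tendsto_L2_bilinear[OF bounded_bilinear_cnj_mult assms(1,2,4) assms(3) assms(3)])
     (simp add: L2_seminorm_def L2_normsq_def)

lemma L2R_polarization:
  assumes "u \<in> L2 lborel" "v \<in> L2 lborel"
  shows "of_real (L2_normsq lborel (\<lambda>x. u x + z * v x)) =
    L2R_inner u u + z * L2R_inner v u + cnj z * L2R_inner u v + z * cnj z * L2R_inner v v"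
proof -
  have zv: "(\<lambda>x. z * v x) \<in> L2 lborel" and uzv: "(\<lambda>x. u x + z * v x) \<in> L2 lborel"
    using assms by (auto intro: L2_cmult L2_add)
  have *: "L2R_inner w (\<lambda>x. u x + z * v x) = L2R_inner w u + cnj z * L2R_inner w v" if "w \<in> L2 lborel" for w
    using L2R_inner_add_left[OF assms(1) zv that, THEN arg_cong[where f = cnj]]
    by (simp add: L2R_inner_cmult_left cnj_L2R_inner)
  show ?thesis
    unfolding L2R_inner_self[symmetric]
    by (simp add: L2R_inner_add_left[OF assms(1) zv uzv] L2R_inner_cmult_left *[OF assms(1)] *[OF assms(2)]
        algebra_simps)
qed

lemma has_sum_sum:
  fixes f :: "'i \<Rightarrow> 'a \<Rightarrow> 'b::topological_comm_monoid_add"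
  assumes "\<And>i. i \<in> I \<Longrightarrow> (f i has_sum s i) A"
  shows "((\<lambda>x. \<Sum>i\<in>I. f i x) has_sum (\<Sum>i\<in>I. s i)) A"
  using assms by (induction I rule: infinite_finite_induct) (auto intro: has_sum_add)

definition orthonormal :: "('b \<Rightarrow> real \<Rightarrow> complex) \<Rightarrow> bool" where
  "orthonormal h \<longleftrightarrow> (\<forall>a. h a \<in> L2 lborel) \<and> (\<forall>a b. L2R_inner (h a) (h b) = of_bool (a = b))"

lemma orthonormal_normsq_sum:
  assumes "orthonormal h" "finite F"
  shows "L2_normsq lborel (\<lambda>x. \<Sum>a\<in>F. c a * h a x) = (\<Sum>a\<in>F. (cmod (c a))\<^sup>2)"
proof -
  have h: "h a \<in> L2 lborel" "L2R_inner (h a) (h b) = of_bool (a = b)" for a b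
    using assms(1) by (auto simp: orthonormal_def)
  have "complex_of_real (L2_normsq lborel (\<lambda>x. \<Sum>a\<in>F. c a * h a x)) =
      (\<Sum>a\<in>F. c a * (\<Sum>b\<in>F. cnj (c b) * L2R_inner (h a) (h b)))"
    unfolding L2R_inner_self[symmetric]
    by (simp add: L2R_inner_sum_left L2R_inner_sum_right h L2_sum L2_cmult)
  also have "\<dots> = (\<Sum>a\<in>F. c a * cnj (c a))"
    using assms(2) by (simp add: h sum.delta if_distrib of_bool_def cong: if_cong)
  also have "\<dots> = complex_of_real (\<Sum>a\<in>F. (cmod (c a))\<^sup>2)"
    by (simp add: complex_norm_square del: of_real_power)
  finally show ?thesis by (simp only: of_real_eq_iff)
qed

lemma Bessel_inequality:
  assumes "orthonormal h" "finite F" "f \<in> L2 lborel"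
  shows "(\<Sum>a\<in>F. (cmod (L2R_inner f (h a)))\<^sup>2) \<le> L2_normsq lborel f"
proof -
  have h: "h a \<in> L2 lborel" for a
    using assms(1) by (auto simp: orthonormal_def)
  define c where "c a = L2R_inner f (h a)" for a
  define S where "S x = (\<Sum>a\<in>F. c a * h a x)" for x
  have S: "S \<in> L2 lborel"
    unfolding S_def using h by (intro L2_sum L2_cmult)
  have fS: "L2R_inner f S = of_real (\<Sum>a\<in>F. (cmod (c a))\<^sup>2)"
    unfolding S_def by (subst L2R_inner_sum_right)
      (auto simp: h assms(3) complex_norm_square mult.commute simp del: of_real_power simp flip: c_def)
  then have Sf: "L2R_inner S f = of_real (\<Sum>a\<in>F. (cmod (c a))\<^sup>2)"
    by (metis cnj_L2R_inner complex_cnj_complex_of_real)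
  have SS: "L2R_inner S S = of_real (\<Sum>a\<in>F. (cmod (c a))\<^sup>2)"
  proof -
    have "S = (\<lambda>x. \<Sum>a\<in>F. c a * h a x)" by (rule ext) (rule S_def)
    then show ?thesis by (simp only: L2R_inner_self orthonormal_normsq_sum[OF assms(1,2)])
  qed
  have "complex_of_real (L2_normsq lborel (\<lambda>x. f x + (-1) * S x)) =
      of_real (L2_normsq lborel f - (\<Sum>a\<in>F. (cmod (c a))\<^sup>2))"
    by (subst L2R_polarization[OF assms(3) S]) (simp add: SS fS Sf L2R_inner_self[of f])
  then have "L2_normsq lborel f - (\<Sum>a\<in>F. (cmod (c a))\<^sup>2) = L2_normsq lborel (\<lambda>x. f x + (-1) * S x)"
    by (simp only: of_real_eq_iff)
  with L2_normsq_nonneg[of lborel "\<lambda>x. f x + (-1) * S x"] show ?thesis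
    by (simp add: c_def)
qed

lemma Bessel_summable:
  assumes "orthonormal h" "f \<in> L2 lborel"
  shows "(\<lambda>a. (cmod (L2R_inner f (h a)))\<^sup>2) summable_on A"
  using Bessel_inequality[OF assms(1) _ assms(2)]
  by (intro nonneg_bdd_above_summable_on) (auto intro!: bdd_aboveI)

text \<open>
  The Fourier series of \<open>f\<close> converges to some \<open>u\<close> because \<open>L\<^sup>2\<close> is complete, and \<open>f - u\<close> is
  orthogonal to the whole system; totality makes it vanish.
\<close>

lemma total_orthonormal_dense:
  fixes h :: "'b::countable \<Rightarrow> real \<Rightarrow> complex"
  assumes on: "orthonormal h"
    and total: "\<And>g. g \<in> L2 lborel \<Longrightarrow> (\<And>a. L2R_inner g (h a) = 0) \<Longrightarrow> AE x in lborel. g x = 0"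
    and f: "f \<in> L2 lborel" and "e > 0"
  obtains c F where "finite F" "L2_seminorm lborel (\<lambda>x. f x - (\<Sum>a\<in>F. c a * h a x)) < e"
proof -
  have h: "h a \<in> L2 lborel" "L2R_inner (h a) (h b) = of_bool (a = b)" for a b
    using on by (auto simp: orthonormal_def)
  define c where "c a = L2R_inner f (h a)" for a
  define F :: "nat \<Rightarrow> 'b set" where "F n = {a. to_nat a < n}" for n
  have fin: "finite (F n)" for n
    unfolding F_def using finite_vimageI[OF finite_lessThan inj_to_nat, of n]
    by (simp add: vimage_def)
  have F_mono: "F m \<subseteq> F n" if "m \<le> n" for m n
    using that by (auto simp: F_def)
  define S where "S n x = (\<Sum>a\<in>F n. c a * h a x)" for n x
  have S: "S n \<in> L2 lborel" for n
    unfolding S_def using h by (intro L2_sum L2_cmult)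
  define q where "q n = (\<Sum>a\<in>F n. (cmod (c a))\<^sup>2)" for n
  have S_diff: "(L2_seminorm lborel (\<lambda>x. S m x - S n x))\<^sup>2 = \<bar>q m - q n\<bar>" for m n
  proof (induction m n rule: linorder_wlog)
    case (le m n)
    have "S n x - S m x = (\<Sum>a\<in>F n - F m. c a * h a x)" for x
      unfolding S_def by (rule sum_diff[symmetric, OF fin F_mono[OF le]])
    moreover have "q n - q m = (\<Sum>a\<in>F n - F m. (cmod (c a))\<^sup>2)"
      unfolding q_def by (rule sum_diff[symmetric, OF fin F_mono[OF le]])
    ultimately have "L2_normsq lborel (\<lambda>x. S n x - S m x) = q n - q m"
      using orthonormal_normsq_sum[OF on, of "F n - F m" c] fin by simp
    then show ?case
      using L2_normsq_nonneg[of lborel "\<lambda>x. S n x - S m x"]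
      by (subst L2_seminorm_commute) (simp add: L2_seminorm_power2)
  next
    case (sym m n)
    then show ?case by (subst L2_seminorm_commute) (simp add: abs_minus_commute)
  qed
  have "incseq q"
    unfolding q_def by (intro incseq_SucI sum_mono2 fin F_mono) simp_all
  moreover have "q n \<le> L2_normsq lborel f" for n
    unfolding q_def c_def by (rule Bessel_inequality[OF on fin f])
  ultimately have "Cauchy q"
    by (metis incseq_convergent LIMSEQ_imp_Cauchy)
  have "\<exists>N. \<forall>m\<ge>N. \<forall>n\<ge>N. L2_seminorm lborel (\<lambda>x. S m x - S n x) \<le> d" if "d > 0" for d
  proof -
    obtain N where N: "\<And>m n. m \<ge> N \<Longrightarrow> n \<ge> N \<Longrightarrow> \<bar>q m - q n\<bar> < d\<^sup>2"
      using CauchyD[OF \<open>Cauchy q\<close>, of "d\<^sup>2"] \<open>d > 0\<close> by auto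
    have "L2_seminorm lborel (\<lambda>x. S m x - S n x) \<le> d" if "m \<ge> N" "n \<ge> N" for m n
      using N[OF that] \<open>d > 0\<close> by (auto simp: S_diff intro: power2_le_imp_le[OF less_imp_le less_imp_le])
    then show ?thesis by blast
  qed
  from L2_complete[OF S this] obtain u where u: "u \<in> L2 lborel"
    and lim: "(\<lambda>n. L2_seminorm lborel (\<lambda>x. u x - S n x)) \<longlonglongrightarrow> 0"
    by blast
  have "L2R_inner u (h a) = c a" for a
  proof (rule LIMSEQ_unique)
    show "(\<lambda>n. L2R_inner (S n) (h a)) \<longlonglongrightarrow> L2R_inner u (h a)"
      by (rule tendsto_L2R_inner[OF S u h(1) lim])
    have "L2R_inner (S n) (h a) = c a" if "n > to_nat a" for n
    proof -
      have "L2R_inner (S n) (h a) = (\<Sum>b\<in>F n. c b * of_bool (b = a))"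
        unfolding S_def by (subst L2R_inner_sum_left) (auto simp: h)
      also have "\<dots> = c a"
        using fin[of n] that by (simp add: of_bool_def if_distrib F_def cong: if_cong)
      finally show ?thesis .
    qed
    then show "(\<lambda>n. L2R_inner (S n) (h a)) \<longlonglongrightarrow> c a"
      by (intro tendsto_eventually) (use eventually_gt_at_top[of "to_nat a"] in eventually_elim, simp)
  qed
  then have "AE x in lborel. f x - u x = 0"
    by (intro total L2_diff f u) (simp add: L2R_inner_diff_left f u h c_def)
  then have "L2_seminorm lborel (\<lambda>x. f x - S n x) = L2_seminorm lborel (\<lambda>x. u x - S n x)" for n
    unfolding L2_seminorm_def L2_normsq_def using f[THEN L2_measurable] u[THEN L2_measurable] S[of n, THEN L2_measurable]
    by (intro arg_cong[where f = sqrt] integral_cong_AE) (auto elim!: eventually_mono)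
  with lim have "(\<lambda>n. L2_seminorm lborel (\<lambda>x. f x - S n x)) \<longlonglongrightarrow> 0"
    by simp
  from order_tendstoD(2)[OF this \<open>e > 0\<close>] obtain n where "L2_seminorm lborel (\<lambda>x. f x - S n x) < e"
    by (auto simp: eventually_sequentially)
  with fin[of n] show ?thesis
    by (intro that[of "F n" c]) (simp_all add: S_def)
qed

text \<open>
  Polarization turns the tight frame identity into its sesquilinear form, of which the right-hand
  side is the special case of two members of the dense system. Conversely, the sesquilinear form
  extends to finite linear combinations, and from these to all of \<open>L\<^sup>2\<close>, since both sides of the
  tight frame identity are squares of seminorms, the left-hand one being dominated by the
  right-hand one.
\<close>

lemma tight_frame_iff_dense:
  fixes e :: "'a \<Rightarrow> real \<Rightarrow> complex" and h :: "'b \<Rightarrow> real \<Rightarrow> complex"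
  assumes e: "\<And>a. e a \<in> L2 lborel" and h: "\<And>b. h b \<in> L2 lborel"
    and dense: "\<And>f d. f \<in> L2 lborel \<Longrightarrow> d > 0 \<Longrightarrow>
      \<exists>c F. finite F \<and> L2_seminorm lborel (\<lambda>x. f x - (\<Sum>b\<in>F. c b * h b x)) < d"
    and B: "B \<ge> 0"
  shows "(\<forall>f\<in>L2 lborel. ((\<lambda>a. (cmod (L2R_inner f (e a)))\<^sup>2) has_sum (B * L2_normsq lborel f)) UNIV) \<longleftrightarrow>
    (\<forall>b b'. ((\<lambda>a. L2R_inner (h b) (e a) * cnj (L2R_inner (h b') (e a))) has_sum
      (of_real B * L2R_inner (h b) (h b'))) UNIV)"
    (is "?tight \<longleftrightarrow> ?gram")
proof
  assume tight: ?tight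
  show ?gram
  proof (intro allI)
    fix b b'
    have hs: "((\<lambda>a. complex_of_real ((cmod (L2R_inner (h b) (e a) + z * L2R_inner (h b') (e a)))\<^sup>2)) has_sum
        of_real B * of_real (L2_normsq lborel (\<lambda>x. h b x + z * h b' x))) UNIV" for z
    proof -
      have zh: "(\<lambda>x. z * h b' x) \<in> L2 lborel" using h by (rule L2_cmult)
      have "((\<lambda>a. (cmod (L2R_inner (\<lambda>x. h b x + z * h b' x) (e a)))\<^sup>2) has_sum
          (B * L2_normsq lborel (\<lambda>x. h b x + z * h b' x))) UNIV"
        using tight L2_add[OF h zh] by blast
      then show ?thesis
        by (subst (asm) has_sum_of_real_iff[symmetric, where 'a = complex])
           (simp add: L2R_inner_add_left[OF h zh e] L2R_inner_cmult_left)
    qed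
    have pol: "1/4 * of_real ((cmod (x + 1 * y))\<^sup>2) + (-1/4) * of_real ((cmod (x + (-1) * y))\<^sup>2)
        + \<i>/4 * of_real ((cmod (x + \<i> * y))\<^sup>2) + (-\<i>/4) * of_real ((cmod (x + (-\<i>) * y))\<^sup>2) = x * cnj y" for x y
      by (simp add: complex_norm_square algebra_simps del: of_real_power)
    have "((\<lambda>a. L2R_inner (h b) (e a) * cnj (L2R_inner (h b') (e a))) has_sum
       (1/4 * (of_real B * of_real (L2_normsq lborel (\<lambda>x. h b x + 1 * h b' x)))
       + (-1/4) * (of_real B * of_real (L2_normsq lborel (\<lambda>x. h b x + (-1) * h b' x)))
       + \<i>/4 * (of_real B * of_real (L2_normsq lborel (\<lambda>x. h b x + \<i> * h b' x)))
       + (-\<i>/4) * (of_real B * of_real (L2_normsq lborel (\<lambda>x. h b x + (-\<i>) * h b' x))))) UNIV"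
      unfolding pol[symmetric]
      by (intro has_sum_add has_sum_cmult_right hs)
    also have "(1/4 * (of_real B * of_real (L2_normsq lborel (\<lambda>x. h b x + 1 * h b' x)))
       + (-1/4) * (of_real B * of_real (L2_normsq lborel (\<lambda>x. h b x + (-1) * h b' x)))
       + \<i>/4 * (of_real B * of_real (L2_normsq lborel (\<lambda>x. h b x + \<i> * h b' x)))
       + (-\<i>/4) * (of_real B * of_real (L2_normsq lborel (\<lambda>x. h b x + (-\<i>) * h b' x))))
       = of_real B * L2R_inner (h b) (h b')"
      unfolding L2R_polarization[OF h h] by (simp add: field_simps)
    finally show "((\<lambda>a. L2R_inner (h b) (e a) * cnj (L2R_inner (h b') (e a))) has_sum
      (of_real B * L2R_inner (h b) (h b'))) UNIV" .
  qed
next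
  assume gram: ?gram
  have span: "((\<lambda>a. (cmod (L2R_inner (\<lambda>x. \<Sum>b\<in>F. c b * h b x) (e a)))\<^sup>2) has_sum
      (B * L2_normsq lborel (\<lambda>x. \<Sum>b\<in>F. c b * h b x))) UNIV" for c F
  proof -
    have "((\<lambda>a. \<Sum>b\<in>F. \<Sum>b'\<in>F. c b * cnj (c b') * (L2R_inner (h b) (e a) * cnj (L2R_inner (h b') (e a)))) has_sum
       (\<Sum>b\<in>F. \<Sum>b'\<in>F. c b * cnj (c b') * (of_real B * L2R_inner (h b) (h b')))) UNIV"
      using gram by (intro has_sum_sum has_sum_cmult_right) auto
    also have "(\<lambda>a. \<Sum>b\<in>F. \<Sum>b'\<in>F. c b * cnj (c b') * (L2R_inner (h b) (e a) * cnj (L2R_inner (h b') (e a))))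
       = (\<lambda>a. complex_of_real ((cmod (L2R_inner (\<lambda>x. \<Sum>b\<in>F. c b * h b x) (e a)))\<^sup>2))"
      unfolding L2R_inner_sum_left[OF h e]
      by (simp add: complex_norm_square sum_product mult_ac del: of_real_power)
    also have "(\<Sum>b\<in>F. \<Sum>b'\<in>F. c b * cnj (c b') * (of_real B * L2R_inner (h b) (h b')))
       = complex_of_real (B * L2_normsq lborel (\<lambda>x. \<Sum>b\<in>F. c b * h b x))"
      by (simp add: L2R_inner_self[symmetric] L2R_inner_sum_left L2R_inner_sum_right h L2_sum L2_cmult
          sum_distrib_left mult_ac)
    finally show ?thesis
      by (simp only: has_sum_of_real_iff)
  qed
  define Q where "Q f G = L2_set (\<lambda>a. cmod (L2R_inner f (e a))) G" for f G
  have Q_triangle: "Q g G \<le> Q f G + Q (\<lambda>x. g x - f x) G" if "f \<in> L2 lborel" "g \<in> L2 lborel" for f g G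
  proof -
    have "Q g G \<le> L2_set (\<lambda>a. cmod (L2R_inner f (e a)) + cmod (L2R_inner (\<lambda>x. g x - f x) (e a))) G"
      unfolding Q_def
    proof (rule L2_set_mono)
      fix a
      have "L2R_inner g (e a) = L2R_inner f (e a) + L2R_inner (\<lambda>x. g x - f x) (e a)"
        using that e[of a] by (simp add: L2R_inner_diff_left)
      then show "cmod (L2R_inner g (e a)) \<le>
          cmod (L2R_inner f (e a)) + cmod (L2R_inner (\<lambda>x. g x - f x) (e a))"
        by (simp add: norm_triangle_ineq)
    qed simp
    also have "\<dots> \<le> Q f G + Q (\<lambda>x. g x - f x) G"
      unfolding Q_def by (rule L2_set_triangle_ineq)
    finally show ?thesis .
  qed
  have Q_span: "Q (\<lambda>x. \<Sum>b\<in>F. c b * h b x) G \<le> sqrt B * L2_seminorm lborel (\<lambda>x. \<Sum>b\<in>F. c b * h b x)"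
    if "finite G" for c F G
    unfolding Q_def L2_set_def L2_seminorm_def real_sqrt_mult[symmetric]
    using finite_sum_le_has_sum[OF span that] by simp
  have upper: "Q f G \<le> sqrt B * L2_seminorm lborel f" if f: "f \<in> L2 lborel" and G: "finite G" for f G
  proof -
    have "\<exists>F c. finite F \<and> L2_seminorm lborel (\<lambda>x. f x - (\<Sum>b\<in>F. c b * h b x)) < inverse (real (Suc n))" for n
      using dense[OF f, of "inverse (real (Suc n))"] by auto
    then obtain F c where Fc: "\<And>n. L2_seminorm lborel (\<lambda>x. f x - (\<Sum>b\<in>F n. c n b * h b x)) < inverse (real (Suc n))"
      by metis
    define g where "g n x = (\<Sum>b\<in>F n. c n b * h b x)" for n x
    have g: "g n \<in> L2 lborel" for n
      unfolding g_def using h by (intro L2_sum L2_cmult)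
    have lim: "(\<lambda>n. L2_seminorm lborel (\<lambda>x. f x - g n x)) \<longlonglongrightarrow> 0"
      using Fc by (intro Lim_null_comparison[OF _ LIMSEQ_inverse_real_of_nat] always_eventually allI)
        (auto simp: g_def L2_seminorm_nonneg intro: less_imp_le)
    have "(\<lambda>n. Q (g n) G) \<longlonglongrightarrow> Q f G"
      unfolding Q_def L2_set_def
      by (intro tendsto_intros tendsto_L2R_inner[OF g f e lim])
    moreover have "(\<lambda>n. sqrt B * L2_seminorm lborel (g n)) \<longlonglongrightarrow> sqrt B * L2_seminorm lborel f"
      by (intro tendsto_intros tendsto_L2_seminorm[OF g f lim])
    moreover have "Q (g n) G \<le> sqrt B * L2_seminorm lborel (g n)" for n
      unfolding g_def by (rule Q_span[OF G])
    ultimately show ?thesis by (auto intro: LIMSEQ_le)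
  qed
  show ?tight
  proof
    fix f :: "real \<Rightarrow> complex" assume f: "f \<in> L2 lborel"
    let ?t = "\<lambda>a. (cmod (L2R_inner f (e a)))\<^sup>2"
    have Q2: "sum ?t G = (Q f G)\<^sup>2" for G
      by (simp add: Q_def L2_set_def sum_nonneg)
    have le: "sum ?t G \<le> B * L2_normsq lborel f" if "finite G" for G
      using power_mono[OF upper[OF f that], of 2] B
      by (simp add: Q2 power_mult_distrib L2_seminorm_power2 Q_def)
    then have summ: "?t summable_on UNIV"
      by (intro nonneg_bdd_above_summable_on) (auto intro!: bdd_aboveI)
    have "sqrt B * L2_seminorm lborel f \<le> sqrt (infsum ?t UNIV) + d" if "d > 0" for d
    proof -
      (* Replacing f by g costs 2 * sqrt B * d' in total; the summand 1 covers B = 0. *)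
      define d' where "d' = d / (2 * sqrt B + 1)"
      have "2 * sqrt B + 1 > 0" using B by (simp add: add_nonneg_pos)
      then have d': "d' > 0" "(2 * sqrt B + 1) * d' = d"
        using \<open>d > 0\<close> by (simp_all add: d'_def)
      from dense[OF f d'(1)] obtain c F where "finite F"
        and close: "L2_seminorm lborel (\<lambda>x. f x - (\<Sum>b\<in>F. c b * h b x)) < d'" by blast
      define g where "g x = (\<Sum>b\<in>F. c b * h b x)" for x
      have g: "g \<in> L2 lborel"
        unfolding g_def using h by (intro L2_sum L2_cmult)
      have fg: "L2_seminorm lborel (\<lambda>x. f x - g x) < d'" "L2_seminorm lborel (\<lambda>x. g x - f x) < d'"
        using close L2_seminorm_commute[of lborel f g] by (auto simp: g_def)
      have "sqrt B * L2_seminorm lborel g \<le> sqrt (infsum ?t UNIV) + sqrt B * d'"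
      proof -
        have lim: "((\<lambda>G. Q g G) \<longlongrightarrow> sqrt B * L2_seminorm lborel g) (finite_subsets_at_top UNIV)"
          using tendsto_real_sqrt[OF span[where F = F and c = c, unfolded has_sum_def]]
          by (simp add: Q_def L2_set_def L2_seminorm_def real_sqrt_mult g_def[THEN ext[of g]])
        have "Q g G \<le> sqrt (infsum ?t UNIV) + sqrt B * d'" if "finite G" for G
        proof -
          have "Q g G \<le> Q f G + Q (\<lambda>x. g x - f x) G"
            by (rule Q_triangle[OF f g])
          also have "Q f G \<le> sqrt (infsum ?t UNIV)"
            unfolding Q_def L2_set_def
            using finite_sum_le_infsum[OF summ that] by simp
          also have "Q (\<lambda>x. g x - f x) G \<le> sqrt B * d'"
            using upper[OF L2_diff[OF g f] that] fg(2) B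
            by (meson less_imp_le mult_left_mono order_trans real_sqrt_ge_zero)
          finally show ?thesis by simp
        qed
        then have "eventually (\<lambda>G. Q g G \<le> sqrt (infsum ?t UNIV) + sqrt B * d') (finite_subsets_at_top UNIV)"
          by (auto simp: eventually_finite_subsets_at_top)
        then show ?thesis
          by (rule tendsto_upperbound[OF lim]) simp
      qed
      moreover have "sqrt B * L2_seminorm lborel f \<le> sqrt B * L2_seminorm lborel g + sqrt B * d'"
        using L2_seminorm_diff[OF f g] fg(1) B
        by (subst distrib_left[symmetric], intro mult_left_mono) auto
      ultimately show ?thesis
        using d' by (simp add: distrib_right)
    qed
    then have "sqrt B * L2_seminorm lborel f \<le> sqrt (infsum ?t UNIV)"
      by (rule field_le_epsilon)
    then have "B * L2_normsq lborel f \<le> infsum ?t UNIV"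
      by (simp add: L2_seminorm_def flip: real_sqrt_mult)
    moreover have "infsum ?t UNIV \<le> B * L2_normsq lborel f"
      using le by (intro infsum_le_finite_sums summ) auto
    ultimately show "(?t has_sum B * L2_normsq lborel f) UNIV"
      using summ by (simp add: has_sum_iff)
  qed
qed

section \<open>The Haar system on the line\<close>

definition wave :: "int \<Rightarrow> int \<Rightarrow> (real \<Rightarrow> complex) \<Rightarrow> real \<Rightarrow> complex" where
  "wave k j f = zpow dilation k (zpow translation j f)"

lemma wave_eq:
  "wave k j f = (\<lambda>x. complex_of_real (2 powr (of_int k / 2)) * f (2 powr of_int k * x - of_int j))"
  by (simp add: wave_def translation_zpow dilation_zpow)

lemma powr_half_mult: "2 powr (a / 2) * 2 powr (b / 2) = (2::real) powr ((a + b) / 2)"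
  by (simp add: add_divide_distrib powr_add)

lemma wave_L2:
  assumes "f \<in> L2 lborel"
  shows "wave k j f \<in> L2 lborel"
proof -
  have [measurable]: "f \<in> borel_measurable borel"
    using L2_measurable[OF assms] by simp
  have "integrable lborel (\<lambda>x. (norm (f (- of_int j + 2 powr of_int k * x)))\<^sup>2)"
    using L2_integrable[OF assms] by (rule lborel_integrable_real_affine) simp
  then have "(\<lambda>x. f (2 powr of_int k * x - of_int j)) \<in> L2 lborel"
    by (simp add: L2_def)
  then show ?thesis
    unfolding wave_eq by (rule L2_cmult)
qed

lemma L2R_inner_wave_right:
  "L2R_inner f (wave k j g) =
    L2R_inner (\<lambda>y. complex_of_real (2 powr (- of_int k / 2)) * f (2 powr (- of_int k) * (y + of_int j))) g"
proof -
  let ?c = "2 powr (- of_int k) :: real" and ?d = "2 powr (of_int k / 2) :: real"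
  have c: "2 powr of_int k * ?c = 1" "?c * ?d = 2 powr (- of_int k / 2)"
    by (simp_all flip: powr_add)
  have "L2R_inner f (wave k j g) =
      ?c *\<^sub>R (LINT y|lborel. f (?c * of_int j + ?c * y) *
        cnj (wave k j g (?c * of_int j + ?c * y)))"
    unfolding L2R_inner_def
    by (subst lborel_integral_real_affine[where c = ?c and t = "?c * of_int j"]) simp_all
  also have "\<dots> = (LINT y|lborel. complex_of_real (?c * ?d) * f (?c * (y + of_int j)) * cnj (g y))"
  proof -
    have "2 powr of_int k * (?c * of_int j + ?c * y) - of_int j = y" for y
      using c(1) by (simp add: distrib_left mult.assoc[symmetric])
    then show ?thesis
      unfolding wave_eq scaleR_conv_of_real
      by (simp add: algebra_simps flip: integral_mult_right_zero)
  qed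
  finally show ?thesis
    unfolding L2R_inner_def c(2) .
qed

lemma L2R_inner_wave_wave: "L2R_inner (wave k j f) (wave k j g) = L2R_inner f g"
proof -
  have "complex_of_real (2 powr (- of_int k / 2)) * wave k j f (2 powr (- of_int k) * (y + of_int j)) = f y" for y
  proof -
    have A: "2 powr of_int k * (2 powr (- of_int k) * (y + of_int j)) = y + of_int j"
      by (simp add: mult.assoc[symmetric] flip: powr_add)
    have B: "2 powr (- of_int k / 2) * 2 powr (of_int k / 2) = (1::real)"
      by (simp flip: powr_add)
    show ?thesis
      unfolding wave_eq A unfolding mult.assoc[symmetric] of_real_mult[symmetric] B by simp
  qed
  then show ?thesis by (simp add: L2R_inner_wave_right)
qed

lemma L2_seminorm_wave: "L2_seminorm lborel (wave k j f) = L2_seminorm lborel f"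
proof -
  have "complex_of_real (L2_normsq lborel (wave k j f)) = of_real (L2_normsq lborel f)"
    by (simp only: L2R_inner_self[symmetric] L2R_inner_wave_wave)
  then show ?thesis by (simp add: L2_seminorm_def)
qed

lemma wave_wave: "wave k j (wave (int n) q f) = wave (k + int n) (2 ^ n * j + q) f"
proof
  fix x
  have "(2::real) ^ n * (2 powr of_int k * x - of_int j) - of_int q =
      2 powr of_int (k + int n) * x - of_int (2 ^ n * j + q)"
    by (simp add: powr_add powr_realpow algebra_simps)
  moreover have "(2::real) powr (of_int k / 2) * 2 powr (real n / 2) = 2 powr (of_int (k + int n) / 2)"
    by (simp add: powr_half_mult)
  ultimately show "wave k j (wave (int n) q f) x = wave (k + int n) (2 ^ n * j + q) f x"
    by (simp add: wave_eq powr_realpow mult.assoc[symmetric] diff_diff_eq flip: of_real_mult)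
qed

abbreviation haar_wave :: "int \<Rightarrow> int \<Rightarrow> real \<Rightarrow> complex" where
  "haar_wave K J \<equiv> wave K J haar_wavelet"

lemma haar_eq_haar_wave: "q < 2 ^ p \<Longrightarrow> haar (2 ^ p + q) = haar_wave (int p) (int q)"
  by (auto simp: haar_dyadic wave_eq powr_realpow)

lemma haar_one: "haar 1 = haar_wavelet"
  using haar_dyadic[of 0 0] by auto

lemma haar_wavelet_measurable [measurable]: "haar_wavelet \<in> borel_measurable borel"
proof -
  have "haar_wavelet = (\<lambda>x. indicator {0..<1/2} x - indicator {1/2..<1} x)"
    by (rule ext) (rule haar_wavelet_def)
  also have "\<dots> \<in> borel_measurable borel" by measurable
  finally show ?thesis .
qed

lemma haar_wavelet_floor:
  "haar_wavelet x = (if \<lfloor>2 * x\<rfloor> = 0 then 1 else if \<lfloor>2 * x\<rfloor> = 1 then -1 else 0)"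
  by (auto simp: haar_wavelet_def indicator_def floor_eq_iff)

lemma haar_zero: "haar 0 = indicator {0..<1}"
  by (rule ext) (simp add: haar_def)

lemma indicator_unit_L2: "(indicator {0..<1} :: real \<Rightarrow> complex) \<in> L2 lborel"
proof -
  have "(norm (indicator {0..<1} x :: complex))\<^sup>2 = indicator {0..<1} x" for x :: real
    by (simp add: indicator_def)
  then show ?thesis by (auto simp: L2_def)
qed

lemma haar_wavelet_L2: "haar_wavelet \<in> L2 lborel"
  by (rule L2_dominated[OF indicator_unit_L2, of _ 1])
     (auto simp: haar_wavelet_def indicator_def split: if_splits)

lemma haar_L2: "haar 0 \<in> L2 lborel"
  by (simp add: haar_zero indicator_unit_L2)

lemma haar_wavelet_L2_unit: "haar_wavelet \<in> L2_unit"
  by (auto simp: L2_unit_def haar_wavelet_L2 haar_wavelet_def)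

lemma L2_unit_L2: "\<phi> \<in> L2_unit \<Longrightarrow> \<phi> \<in> L2 lborel"
  by (simp add: L2_unit_def)

lemma L2_unit_AE:
  assumes "\<phi> \<in> L2_unit"
  shows "AE x in lborel. x \<notin> {0..<1} \<longrightarrow> \<phi> x = 0"
proof -
  have "AE x in lborel. x \<notin> {0..1} \<longrightarrow> \<phi> x = 0"
    using assms by (simp add: L2_unit_def)
  moreover have "AE x in lborel. x \<noteq> (1::real)"
    by (rule AE_lborel_singleton)
  ultimately show ?thesis by eventually_elim auto
qed

lemma L2R_inner_cong_unit:
  assumes "\<phi> \<in> L2_unit" "f \<in> borel_measurable borel" "g \<in> borel_measurable borel"
    and "\<And>x. x \<in> {0..<1} \<Longrightarrow> f x = g x"
  shows "L2R_inner f \<phi> = L2R_inner g \<phi>"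
proof -
  have "\<phi> \<in> borel_measurable borel"
    using L2_measurable[OF L2_unit_L2[OF assms(1)]] by simp
  moreover have "AE x in lborel. f x * cnj (\<phi> x) = g x * cnj (\<phi> x)"
    using L2_unit_AE[OF assms(1)] by eventually_elim (use assms(4) in auto)
  ultimately show ?thesis
    unfolding L2R_inner_def using assms(2,3)
    by (intro integral_cong_AE L2_borel_measurable_bilinear[OF bounded_bilinear_cnj_mult]) auto
qed

lemma haar_wavelet_inner_haar_zero: "L2R_inner haar_wavelet (haar 0) = 0"
proof -
  have "L2R_inner haar_wavelet (haar 0) =
      (LINT x|lborel. complex_of_real (indicator {0..<1/2::real} x - indicator {1/2..<1} x))"
    unfolding L2R_inner_def haar_zero
    by (intro Bochner_Integration.integral_cong) (auto simp: haar_wavelet_def indicator_def)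
  also have "\<dots> = of_real (LINT x|lborel. indicator {0..<1/2::real} x - indicator {1/2..<1} x)"
    by (rule integral_complex_of_real)
  also have "(LINT x|lborel. indicator {0..<1/2::real} x - indicator {1/2..<1} x) = (0::real)"
    by (subst Bochner_Integration.integral_diff) (auto intro!: integrable_real_indicator emeasure_bounded_finite)
  finally show ?thesis by simp
qed

lemma haar_wavelet_inner_self: "L2R_inner haar_wavelet haar_wavelet = 1"
proof -
  have "L2R_inner haar_wavelet haar_wavelet = (LINT x|lborel. complex_of_real (indicator {0..<1::real} x))"
    unfolding L2R_inner_def
    by (intro Bochner_Integration.integral_cong) (auto simp: haar_wavelet_def indicator_def)
  also have "\<dots> = of_real (LINT x|lborel. indicator {0..<1::real} x)"
    by (rule integral_complex_of_real)
  finally show ?thesis by simp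
qed

text \<open>
  A Haar function at a level coarser than the copy of \<open>\<phi>\<close> is constant on the support of that
  copy, and \<open>\<phi>\<close> has mean zero. Otherwise rescaling turns the copy into \<open>\<phi>\<close> itself and the Haar
  function into one of level \<open>n \<ge> 0\<close>, which meets \<open>[0,1]\<close> only if it belongs to the Haar basis
  of \<open>L\<^sup>2[0,1]\<close>.
\<close>

lemma haar_wave_inner_wave_coarse:
  assumes \<phi>: "\<phi> \<in> L2_unit" "L2R_inner \<phi> (haar 0) = 0" and "K < k"
  shows "L2R_inner (haar_wave K J) (wave k j \<phi>) = 0"
proof -
  define n where "n = nat (k - K - 1)"
  have k: "k = K + int (Suc n)"
    using \<open>K < k\<close> by (simp add: n_def)
  define j' where "j' = j - 2 ^ Suc n * J"
  define C where "C = complex_of_real (2 powr (- of_int (int (Suc n)) / 2)) *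
    haar_wavelet (of_int j' / 2 ^ Suc n)"
  have "wave k j \<phi> = wave K J (wave (int (Suc n)) j' \<phi>)"
    unfolding wave_wave k j'_def by simp
  then have "L2R_inner (haar_wave K J) (wave k j \<phi>) = L2R_inner haar_wavelet (wave (int (Suc n)) j' \<phi>)"
    by (simp only: L2R_inner_wave_wave)
  also have "\<dots> = L2R_inner (\<lambda>y. C * haar 0 y) \<phi>"
    unfolding L2R_inner_wave_right
  proof (rule L2R_inner_cong_unit[OF \<phi>(1)])
    fix y :: real assume y: "y \<in> {0..<1}"
    have "2 powr (- of_int (int (Suc n))) = 1 / (2::real) ^ Suc n"
      by (simp only: of_int_of_nat_eq powr_minus powr_realpow zero_less_numeral inverse_eq_divide)
    then have "2 * (2 powr (- of_int (int (Suc n))) * (y + of_int j')) = (y + of_int j') / of_int (2 ^ n)"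
      by (simp add: field_simps)
    then have "\<lfloor>2 * (2 powr (- of_int (int (Suc n))) * (y + of_int j'))\<rfloor> = \<lfloor>(y + of_int j') / of_int (2 ^ n)\<rfloor>"
      by (simp only:)
    also have "\<dots> = \<lfloor>y + of_int j'\<rfloor> div 2 ^ n"
      by (rule floor_divide_real_eq_div) simp
    also have "\<lfloor>y + of_int j'\<rfloor> = j'"
      using y by (simp add: floor_eq_iff)
    also have "j' div 2 ^ n = \<lfloor>(of_int j' :: real) / of_int (2 ^ n)\<rfloor>"
      by (simp only: floor_divide_of_int_eq)
    also have "\<dots> = \<lfloor>2 * ((of_int j' :: real) / 2 ^ Suc n)\<rfloor>"
      by simp
    finally show "complex_of_real (2 powr (- of_int (int (Suc n)) / 2)) *
        haar_wavelet (2 powr (- of_int (int (Suc n))) * (y + of_int j')) = C * haar 0 y"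
      using y unfolding C_def haar_wavelet_floor[of "2 powr _ * _"] haar_wavelet_floor[of "_ / _"]
      by (simp add: haar_zero)
  qed (auto simp: haar_zero)
  also have "\<dots> = C * cnj (L2R_inner \<phi> (haar 0))"
    by (simp add: L2R_inner_cmult_left cnj_L2R_inner)
  finally show ?thesis using \<phi>(2) by simp
qed

lemma haar_wave_inner_wave:
  assumes \<phi>: "\<phi> \<in> L2_unit" "L2R_inner \<phi> (haar 0) = 0"
  shows "L2R_inner (haar_wave K J) (wave k j \<phi>) =
    (if k \<le> K \<and> j = J div 2 ^ nat (K - k)
     then cnj (L2R_inner \<phi> (haar (2 ^ nat (K - k) + nat (J mod 2 ^ nat (K - k))))) else 0)"
proof (cases "k \<le> K")
  case True
  define n where "n = nat (K - k)"
  have K: "K = k + int n" using True by (simp add: n_def)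
  define q where "q = J - 2 ^ n * j"
  have "haar_wave K J = wave k j (haar_wave (int n) q)"
    unfolding wave_wave K q_def by simp
  then have *: "L2R_inner (haar_wave K J) (wave k j \<phi>) = L2R_inner (haar_wave (int n) q) \<phi>"
    by (simp only: L2R_inner_wave_wave)
  show ?thesis
  proof (cases "j = J div 2 ^ n")
    case j: True
    have q: "q = J mod 2 ^ n"
      unfolding q_def j by (simp add: minus_mult_div_eq_mod)
    then have "0 \<le> q" "q < 2 ^ n" by auto
    then have "nat q < 2 ^ n" by (simp add: nat_less_iff)
    from haar_eq_haar_wave[OF this] have "haar (2 ^ n + nat q) = haar_wave (int n) q"
      using \<open>0 \<le> q\<close> by simp
    then show ?thesis
      using True j * by (simp add: cnj_L2R_inner flip: n_def q)
  next
    case False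
    have "\<not> (0 \<le> q \<and> q < 2 ^ n)"
    proof
      assume "0 \<le> q \<and> q < 2 ^ n"
      then have "J div 2 ^ n = j"
        by (intro int_div_pos_eq[of _ _ _ q]) (auto simp: q_def)
      with False show False by simp
    qed
    have "L2R_inner (haar_wave (int n) q) \<phi> = L2R_inner (\<lambda>x. 0) \<phi>"
    proof (rule L2R_inner_cong_unit[OF \<phi>(1)])
      fix x :: real assume x: "x \<in> {0..<1}"
      have "\<not> (0 \<le> 2 ^ n * x - of_int q \<and> 2 ^ n * x - of_int q < 1)"
      proof
        assume A: "0 \<le> 2 ^ n * x - of_int q \<and> 2 ^ n * x - of_int q < 1"
        have "0 \<le> 2 ^ n * x" "2 ^ n * x < 2 ^ n" using x by auto
        with A have "- 1 < (of_int q :: real)" "(of_int q :: real) < 2 ^ n" by linarith+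
        then have "0 \<le> q" "q < 2 ^ n"
          using of_int_less_iff[of q "2 ^ n", where 'a = real] by simp_all
        with \<open>\<not> (0 \<le> q \<and> q < 2 ^ n)\<close> show False by simp
      qed
      then have "haar_wavelet (2 ^ n * x - of_int q) = 0"
        by (auto simp: haar_wavelet_def indicator_def)
      then show "haar_wave (int n) q x = 0"
        by (simp add: wave_eq powr_realpow)
    qed (auto simp: wave_eq)
    then show ?thesis
      using False * by (simp add: L2R_inner_zero_left flip: n_def)
  qed
next
  case False
  then show ?thesis using haar_wave_inner_wave_coarse[OF \<phi>, of K k J j] by simp
qed

text \<open>
  The mother wavelet is itself a function on \<open>[0,1]\<close> with mean zero, so that the inner products of
  two Haar functions are among those just computed; by symmetry the second one may be taken at the
  finer level.
\<close>

lemma orthonormal_haar: "orthonormal (\<lambda>(K, J). haar_wave K J)"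
proof -
  have le: "L2R_inner (haar_wave K J) (haar_wave k j) = of_bool (K = k \<and> J = j)" if "K \<le> k" for K J k j
  proof (cases "K = k")
    case True
    then show ?thesis
      by (subst haar_wave_inner_wave[OF haar_wavelet_L2_unit haar_wavelet_inner_haar_zero])
         (auto simp: haar_one[unfolded One_nat_def] haar_wavelet_inner_self)
  next
    case False
    then show ?thesis
      using haar_wave_inner_wave_coarse[OF haar_wavelet_L2_unit haar_wavelet_inner_haar_zero, of K k J j] that
      by simp
  qed
  have "L2R_inner (haar_wave K J) (haar_wave k j) = of_bool (K = k \<and> J = j)" for K J k j
  proof (cases "K \<le> k")
    case False
    then have "L2R_inner (haar_wave K J) (haar_wave k j) = cnj (of_bool (k = K \<and> j = J))"
      by (subst L2R_inner_commute) (simp only: le)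
    then show ?thesis by (auto simp: of_bool_def)
  qed (rule le)
  then show ?thesis
    by (auto simp: orthonormal_def wave_L2 haar_wavelet_L2)
qed

section \<open>Totality of the Haar system\<close>

lemma haar_refinement:
  "haar_wave K J = (\<lambda>x. complex_of_real (2 powr (-1/2)) *
     (wave (K + 1) (2 * J) (haar 0) x - wave (K + 1) (2 * J + 1) (haar 0) x))" (is ?wavelet)
  "wave K J (haar 0) = (\<lambda>x. complex_of_real (2 powr (-1/2)) *
     (wave (K + 1) (2 * J) (haar 0) x + wave (K + 1) (2 * J + 1) (haar 0) x))" (is ?scaling)
proof -
  let ?c = "complex_of_real (2 powr (-1/2))"
  have c: "complex_of_real (2 powr (-1/2)) * (of_real (2 powr (1/2)) * y) = y" for y
    by (simp add: mult.assoc[symmetric] flip: of_real_mult powr_add)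
  have cc: "complex_of_real (2 powr - (1/2)) * of_real (2 powr (1/2)) = 1"
    by (simp flip: of_real_mult powr_add)
  have 1: "haar_wavelet = (\<lambda>x. ?c * (wave (int 1) 0 (haar 0) x - wave (int 1) 1 (haar 0) x))"
    by (rule ext, simp only: wave_eq right_diff_distrib of_int_of_nat_eq of_nat_1 c)
      (auto simp: haar_zero haar_wavelet_def indicator_def cc)
  have 2: "haar 0 = (\<lambda>x. ?c * (wave (int 1) 0 (haar 0) x + wave (int 1) 1 (haar 0) x))"
    by (rule ext, simp only: wave_eq distrib_left of_int_of_nat_eq of_nat_1 c)
      (auto simp: haar_zero indicator_def cc)
  have wave_lin: "wave K J (\<lambda>x. d * (f x - g x)) = (\<lambda>x. d * (wave K J f x - wave K J g x))"
    "wave K J (\<lambda>x. d * (f x + g x)) = (\<lambda>x. d * (wave K J f x + wave K J g x))" for d f g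
    by (auto simp: wave_eq algebra_simps)
  have "haar_wave K J = wave K J (\<lambda>x. ?c * (wave (int 1) 0 (haar 0) x - wave (int 1) 1 (haar 0) x))"
    by (rule arg_cong[OF 1])
  then show ?wavelet
    unfolding wave_lin wave_wave by simp
  have "wave K J (haar 0) = wave K J (\<lambda>x. ?c * (wave (int 1) 0 (haar 0) x + wave (int 1) 1 (haar 0) x))"
    by (rule arg_cong[OF 2])
  then show ?scaling
    unfolding wave_lin wave_wave by simp
qed

text \<open>
  Orthogonality to the Haar functions makes the integrals over the two halves of every dyadic
  interval agree. So the normalized integral shrinks by the factor \<open>2 powr (-1/2)\<close> from each dyadic
  interval to either of its halves, while it is bounded uniformly over all dyadic intervals, also
  the large ones.
\<close>

lemma orthogonal_haar_imp_scaling_zero: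
  assumes g: "g \<in> L2 lborel" and orth: "\<And>K J. L2R_inner g (haar_wave K J) = 0"
  shows "L2R_inner g (wave K J (haar 0)) = 0"
proof -
  define c where "c = complex_of_real (2 powr (-1/2))"
  have "c \<noteq> 0" "cnj c = c" and norm_c: "norm c = 2 powr (-1/2)" by (auto simp: c_def)
  define a where "a K J = L2R_inner (wave K J (haar 0)) g" for K J
  have w: "wave K J (haar 0) \<in> L2 lborel" for K J
    by (rule wave_L2[OF haar_L2])
  have half: "a (K + 1) J = c * a K (J div 2)" for K J
  proof -
    define J2 where "J2 = J div 2"
    have "0 = L2R_inner (haar_wave K J2) g"
      using orth[of K J2] by (subst L2R_inner_commute) simp
    also have "\<dots> = c * (a (K + 1) (2 * J2) - a (K + 1) (2 * J2 + 1))"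
      unfolding haar_refinement(1)[of K J2] a_def c_def
      by (simp add: L2R_inner_cmult_left L2R_inner_diff_left w g)
    finally have eq: "a (K + 1) (2 * J2) = a (K + 1) (2 * J2 + 1)"
      using \<open>c \<noteq> 0\<close> by simp
    have "a K J2 = c * (a (K + 1) (2 * J2) + a (K + 1) (2 * J2 + 1))"
      unfolding a_def c_def haar_refinement(2)[of K J2]
      by (simp add: L2R_inner_cmult_left L2R_inner_add_left w g)
    then have "c * a K J2 = (c * c * 2) * a (K + 1) (2 * J2)"
      by (simp add: eq)
    also have "c * c = 1/2"
      by (simp add: c_def powr_minus_divide flip: of_real_mult powr_add)
    finally have "a (K + 1) (2 * J2) = c * a K J2" by simp
    moreover have "J = 2 * J2 \<or> J = 2 * J2 + 1"
      unfolding J2_def by presburger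
    ultimately show ?thesis
      using eq J2_def by auto
  qed
  have iterate: "a K J = c ^ n * a (K - int n) (J div 2 ^ n)" for n K J
  proof (induction n)
    case (Suc n)
    have "a (K - int n) (J div 2 ^ n) = c * a (K - int (Suc n)) (J div 2 ^ n div 2)"
      using half[of "K - int (Suc n)"] by simp
    moreover have "J div 2 ^ n div 2 = J div 2 ^ Suc n"
      unfolding power_Suc2 by (rule zdiv_zmult2_eq[symmetric]) simp
    ultimately show ?case
      using Suc by simp
  qed simp
  obtain C where C: "C \<ge> 0" "\<And>u v. u \<in> L2 lborel \<Longrightarrow> v \<in> L2 lborel \<Longrightarrow>
      cmod (L2R_inner u v) \<le> C * (L2_seminorm lborel u * L2_seminorm lborel v)"
    using L2_bilinear_bound[OF bounded_bilinear_cnj_mult, of "lborel :: real measure"]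
    unfolding L2R_inner_def by blast
  define D where "D = C * (L2_seminorm lborel (haar 0) * L2_seminorm lborel g)"
  have "cmod (a K J) \<le> D * (2 powr (-1/2)) ^ n" for n
  proof -
    have "cmod (a K J) = (2 powr (-1/2)) ^ n * cmod (a (K - int n) (J div 2 ^ n))"
      by (subst iterate[of K J n]) (simp add: norm_mult norm_power norm_c)
    also have "cmod (a (K - int n) (J div 2 ^ n)) \<le> D"
      unfolding a_def D_def using C(2)[OF w g] by (simp add: L2_seminorm_wave)
    finally show ?thesis by (simp add: mult.commute)
  qed
  moreover have "(2::real) powr (-1/2) < 1"
    by (simp add: powr_less_one)
  then have "(\<lambda>n. D * (2 powr (-1/2)) ^ n) \<longlonglongrightarrow> D * 0"
    by (intro tendsto_mult_left LIMSEQ_realpow_zero) auto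
  ultimately have "cmod (a K J) \<le> 0"
    using LIMSEQ_le_const[of _ "D * 0" "cmod (a K J)"] by simp
  then show ?thesis
    by (subst L2R_inner_commute) (simp add: a_def)
qed

definition dyadic :: "nat \<Rightarrow> int \<Rightarrow> real set" where
  "dyadic n j = {x. \<lfloor>2 ^ n * x\<rfloor> = j}"

lemma dyadic_measurable [measurable]: "dyadic n j \<in> sets borel"
  unfolding dyadic_def by measurable

lemma dyadic_nested:
  assumes "m \<le> n"
  shows "dyadic m i \<inter> dyadic n j = (if i = j div 2 ^ (n - m) then dyadic n j else {})"
proof -
  have "\<lfloor>2 ^ m * x\<rfloor> = \<lfloor>2 ^ n * x\<rfloor> div 2 ^ (n - m)" for x :: real
  proof -
    have "(2::real) ^ n = 2 ^ m * 2 ^ (n - m)"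
      using assms by (simp flip: power_add)
    then have "2 ^ m * x = (2 ^ n * x) / of_int (2 ^ (n - m))"
      by simp
    then show ?thesis
      by (simp only: floor_divide_real_eq_div zero_le_power zero_le_numeral)
  qed
  then show ?thesis by (auto simp: dyadic_def)
qed

lemma borel_eq_sigma_dyadic: "sets borel \<subseteq> sigma_sets UNIV (insert {} (range (\<lambda>(n, j). dyadic n j)))"
    (is "_ \<subseteq> sigma_sets UNIV ?G")
proof -
  have "S \<in> sigma_sets UNIV ?G" if "open S" for S :: "real set"
  proof -
    have "S = \<Union>{A \<in> ?G. A \<subseteq> S}"
    proof (intro equalityI subsetI)
      fix x assume "x \<in> S"
      with \<open>open S\<close> obtain e where e: "e > 0" "ball x e \<subseteq> S"
        by (auto simp: open_contains_ball)
      then obtain n where n: "(1/2::real) ^ n < e"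
        using real_arch_pow_inv[of e "1/2"] by auto
      have "dyadic n \<lfloor>2 ^ n * x\<rfloor> \<subseteq> ball x e"
      proof
        fix y assume "y \<in> dyadic n \<lfloor>2 ^ n * x\<rfloor>"
        then have "\<bar>2 ^ n * x - 2 ^ n * y\<bar> < 1"
          unfolding dyadic_def by (simp add: abs_less_iff) linarith
        also have "\<bar>2 ^ n * x - 2 ^ n * y\<bar> = 2 ^ n * \<bar>x - y\<bar>"
          by (simp add: abs_mult flip: right_diff_distrib)
        finally have "\<bar>x - y\<bar> < (1/2) ^ n"
          by (simp add: power_one_over pos_less_divide_eq mult.commute)
        with n show "y \<in> ball x e" by (simp add: dist_real_def)
      qed
      with e(2) show "x \<in> \<Union>{A \<in> ?G. A \<subseteq> S}"
        by (intro UnionI[of "dyadic n \<lfloor>2 ^ n * x\<rfloor>"]) (auto simp: dyadic_def)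
    qed auto
    moreover have "\<Union>{A \<in> ?G. A \<subseteq> S} \<in> sigma_sets UNIV ?G"
      by (rule sigma_sets_UNION) (auto intro: countable_subset[of _ ?G])
    ultimately show ?thesis by simp
  qed
  then have "sigma_sets UNIV {S :: real set. open S} \<subseteq> sigma_sets UNIV ?G"
    by (intro sigma_sets_mono) auto
  then show ?thesis by (simp add: sets_borel)
qed

text \<open>
  The sets \<open>A\<close> for which the integral over \<open>A\<close> intersected with a unit cell vanishes form a Dynkin
  system, and the dyadic intervals are an intersection-stable generator of the Borel sets.
\<close>

lemma AE_zero_if_dyadic_integrals_zero:
  fixes g :: "real \<Rightarrow> complex"
  assumes g: "g \<in> L2 lborel"
    and dyadic: "\<And>n j. (LINT x:dyadic n j|lborel. g x) = 0"
  shows "AE x in lborel. g x = 0"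
proof -
  have [measurable]: "g \<in> borel_measurable borel"
    using L2_measurable[OF g] by simp
  have cell: "AE x in lborel. x \<in> dyadic 0 m \<longrightarrow> g x = 0" for m
  proof -
    let ?Z = "dyadic 0 m"
    have intZ: "set_integrable lborel ?Z g"
    proof -
      have "integrable lborel (indicator ?Z :: real \<Rightarrow> real)"
      proof (rule integrable_real_indicator)
        have "?Z \<subseteq> {of_int m .. of_int m + 1}"
          by (auto simp: dyadic_def floor_eq_iff)
        then show "emeasure lborel ?Z < \<infinity>"
          by (intro emeasure_bounded_finite) (rule bounded_subset[OF bounded_closed_interval])
      qed simp
      then have "(indicator ?Z :: real \<Rightarrow> real) \<in> L2 lborel"
      proof -
        have "(norm (indicator ?Z x :: real))\<^sup>2 = indicator ?Z x" for x
          by (simp add: indicator_def)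
        then show ?thesis
          using \<open>integrable lborel (indicator ?Z)\<close> by (simp add: L2_def)
      qed
      from L2_integrable_bilinear[OF bounded_bilinear_scaleR this g] show ?thesis
        by (simp add: set_integrable_def)
    qed
    have int_A: "set_integrable lborel (A \<inter> ?Z) g" if "A \<in> sets borel" for A
      using that by (intro set_integrable_subset[OF intZ]) auto
    let ?G = "insert {} (range (\<lambda>(n, j). dyadic n j))"
    have G_borel: "sigma_sets UNIV ?G \<subseteq> sets borel"
    proof -
      have "?G \<subseteq> sets borel" by auto
      from sets.sigma_sets_subset[OF this] show ?thesis by simp
    qed
    have zero: "(LINT x:A \<inter> ?Z|lborel. g x) = 0" if "A \<in> sets borel" for A
    proof -
      have "Int_stable ?G"
      proof (rule Int_stableI)
        fix A B assume AB: "A \<in> ?G" "B \<in> ?G"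
        have D: "dyadic n i \<inter> dyadic n' j \<in> ?G" for n i n' j
        proof (cases "n \<le> n'")
          case True
          then show ?thesis by (auto simp: dyadic_nested)
        next
          case False
          then show ?thesis by (subst Int_commute) (auto simp: dyadic_nested)
        qed
        show "A \<inter> B \<in> ?G"
        proof (cases "A = {} \<or> B = {}")
          case False
          with AB obtain n i n' j where "A = dyadic n i" "B = dyadic n' j" by auto
          then show ?thesis using D by simp
        qed auto
      qed
      moreover have "?G \<subseteq> Pow UNIV" by simp
      moreover have "A \<in> sigma_sets UNIV ?G"
        using that borel_eq_sigma_dyadic by blast
      ultimately show ?thesis
      proof (induction rule: sigma_sets_induct_disjoint)
        case (basic A)
        then obtain n j where "A = {} \<or> A = dyadic n j" by auto
        then show ?case
          using dyadic_nested[of 0 n m j]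
          using dyadic[of n j]
          by (auto simp: Int_commute[of "dyadic n j"] set_lebesgue_integral_def)
      next
        case empty
        then show ?case by (simp add: set_lebesgue_integral_def)
      next
        case (compl A)
        have A: "A \<in> sets borel" using compl(1) G_borel by blast
        have "(LINT x:?Z|lborel. g x) = (LINT x:((A \<inter> ?Z) \<union> ((UNIV - A) \<inter> ?Z))|lborel. g x)"
          by (rule arg_cong[where f = "\<lambda>S. LINT x:S|lborel. g x"]) auto
        also have "\<dots> = (LINT x:A \<inter> ?Z|lborel. g x) + (LINT x:(UNIV - A) \<inter> ?Z|lborel. g x)"
          using A by (intro set_integral_Un int_A) auto
        finally show ?case using compl(2) dyadic by simp
      next
        case (union A)
        have A: "A i \<in> sets borel" for i using union(2) G_borel by blast
        have "(LINT x:(\<Union>i. A i) \<inter> ?Z|lborel. g x) = (LINT x:(\<Union>i. A i \<inter> ?Z)|lborel. g x)"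
          by (simp add: Int_UN_distrib2)
        also have "\<dots> = (\<Sum>i. LINT x:A i \<inter> ?Z|lborel. g x)"
        proof (rule lebesgue_integral_countable_add)
          show "A i \<inter> ?Z \<inter> (A j \<inter> ?Z) = {}" if "i \<noteq> j" for i j
            using union(1) that by (auto simp: disjoint_family_on_def)
          show "set_integrable lborel (\<Union>i. A i \<inter> ?Z) g"
            using int_A[of "\<Union>i. A i"] A by (auto simp: Int_UN_distrib2)
        qed (use A in auto)
        finally show ?case using union(3) by simp
      qed
    qed
    (* Used for u in {1, -1, i, -i}: the four half-planes meet only in 0. *)
    have half: "AE x in lborel. x \<in> ?Z \<longrightarrow> Re (u * g x) \<le> 0" for u
    proof -
      let ?A = "{x. Re (u * g x) > 0}"
      have A: "?A \<in> sets borel" by measurable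
      let ?f = "\<lambda>x. indicator (?A \<inter> ?Z) x * Re (u * g x)"
      have int: "integrable lborel (\<lambda>x. indicator (?A \<inter> ?Z) x *\<^sub>R g x)"
        using int_A[OF A] by (simp add: set_integrable_def)
      have f_eq: "?f x = Re (u * (indicator (?A \<inter> ?Z) x *\<^sub>R g x))" for x
        by (simp add: indicator_def)
      have "(LINT x|lborel. ?f x) = Re (u * (LINT x:?A \<inter> ?Z|lborel. g x))"
        unfolding f_eq set_lebesgue_integral_def integral_Re[OF integrable_mult_right[OF int]]
        by (simp only: Bochner_Integration.integral_mult_right_zero)
      also have "\<dots> = 0" using zero[OF A] by simp
      finally have "AE x in lborel. ?f x = 0"
      proof (subst (asm) integral_nonneg_eq_0_iff_AE)
        show "integrable lborel ?f"
          unfolding f_eq using int by (intro integrable_Re integrable_mult_right)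
      qed (auto simp: indicator_def)
      then show ?thesis
        by eventually_elim (auto simp: indicator_def not_less split: if_splits)
    qed
    show ?thesis
      using half[of 1] half[of "-1"] half[of \<i>] half[of "-\<i>"]
      by eventually_elim (auto simp: complex_eq_iff)
  qed
  have "AE x in lborel. \<forall>m. x \<in> dyadic 0 m \<longrightarrow> g x = 0"
    unfolding AE_all_countable using cell by blast
  then show ?thesis
    by eventually_elim (auto simp: dyadic_def)
qed

lemma haar_total:
  assumes g: "g \<in> L2 lborel" and orth: "\<And>K J. L2R_inner g (haar_wave K J) = 0"
  shows "AE x in lborel. g x = 0"
proof (rule AE_zero_if_dyadic_integrals_zero[OF g])
  fix n j
  have "0 = L2R_inner (wave (int n) j (haar 0)) g"
    using orthogonal_haar_imp_scaling_zero[OF g orth, of "int n" j]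
    by (subst L2R_inner_commute) simp
  also have "wave (int n) j (haar 0) = (\<lambda>x. complex_of_real (2 powr (real n / 2)) * indicator (dyadic n j) x)"
    by (rule ext) (auto simp: wave_eq haar_zero dyadic_def powr_realpow indicator_def floor_eq_iff)
  also have "L2R_inner \<dots> g = of_real (2 powr (real n / 2)) * cnj (LINT x:dyadic n j|lborel. g x)"
    unfolding L2R_inner_cmult_left unfolding L2R_inner_def set_lebesgue_integral_def
    by (auto simp: indicator_def intro!: Bochner_Integration.integral_cong
        simp flip: Bochner_Integration.integral_cnj)
  finally show "(LINT x:dyadic n j|lborel. g x) = 0" by simp
qed

lemma haar_dense:
  assumes "f \<in> L2 lborel" "d > 0"
  shows "\<exists>c F. finite F \<and> L2_seminorm lborel (\<lambda>x. f x - (\<Sum>b\<in>F. c b * (case b of (K, J) \<Rightarrow> haar_wave K J) x)) < d"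
proof -
  have "AE x in lborel. g x = 0" if "g \<in> L2 lborel"
    "\<And>b. L2R_inner g (case b of (K, J) \<Rightarrow> haar_wave K J) = 0" for g
    using haar_total[OF that(1)] that(2)[of "(_, _)"] by simp
  from total_orthonormal_dense[OF orthonormal_haar this assms] show ?thesis
    by blast
qed

section \<open>Power series in the Hardy space\<close>

lemma bounded_bilinear_vec_inner:
  "bounded_bilinear (vec_inner :: complex ^ 'r::finite \<Rightarrow> complex ^ 'r \<Rightarrow> complex)"
  unfolding bilinear_conv_bounded_bilinear[symmetric] bilinear_def
  by (auto intro!: linearI simp: vec_inner_def algebra_simps sum.distrib sum_distrib_left scaleR_conv_of_real[where 'a = complex])

lemma bounded_bilinear_vector_scalar_mult:
  "bounded_bilinear ((*s) :: complex \<Rightarrow> complex ^ 'r::finite \<Rightarrow> complex ^ 'r)"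
  unfolding bilinear_conv_bounded_bilinear[symmetric] bilinear_def
  by (auto intro!: linearI simp: vec_eq_iff algebra_simps scaleR_conv_of_real[where 'a = complex])

lemma vec_inner_self: "vec_inner u u = of_real ((norm u)\<^sup>2)"
  unfolding vec_inner_def norm_vec_def L2_set_def
  by (simp add: sum_nonneg complex_norm_square del: of_real_power)

lemma vec_inner_zero [simp]: "vec_inner 0 v = 0" "vec_inner u 0 = 0"
  by (simp_all add: vec_inner_def)

lemma vec_inner_scalar: "vec_inner (a *s u) (b *s v) = a * cnj b * vec_inner u v"
  by (simp add: vec_inner_def sum_distrib_left mult_ac)

lemma norm_vector_scalar_mult: "norm (a *s (u :: complex ^ 'r::finite)) = cmod a * norm u"
  by (simp add: norm_vec_def norm_mult L2_set_right_distrib)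

lemma norm_vec_inner_le: "cmod (vec_inner u v) \<le> ((norm u)\<^sup>2 + (norm v)\<^sup>2) / 2"
proof -
  have "cmod (vec_inner u v) \<le> (\<Sum>j\<in>UNIV. ((cmod (u $ j))\<^sup>2 + (cmod (v $ j))\<^sup>2) / 2)"
    unfolding vec_inner_def
  proof (rule sum_norm_le)
    fix j
    show "cmod (u $ j * cnj (v $ j)) \<le> ((cmod (u $ j))\<^sup>2 + (cmod (v $ j))\<^sup>2) / 2"
      using sum_squares_bound[of "cmod (u $ j)" "cmod (v $ j)"] by (simp add: norm_mult)
  qed
  also have "\<dots> = ((norm u)\<^sup>2 + (norm v)\<^sup>2) / 2"
    by (simp add: norm_vec_def L2_set_def sum_nonneg sum.distrib flip: sum_divide_distrib)
  finally show ?thesis .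
qed

lemma circle_measure_simps [simp, measurable_cong]:
  "sets circle_measure = sets borel" "space circle_measure = UNIV"
  by (simp_all add: circle_measure_def)

lemma cis_measurable: "cis \<in> borel_measurable borel"
  by (intro borel_measurable_continuous_onI continuous_intros)

lemma AE_circle: "AE \<omega> in circle_measure. cmod \<omega> = 1"
  unfolding circle_measure_def
  by (subst AE_distr_iff) (auto simp: cis_measurable measurable_cong_sets[OF sets_uniform_measure refl])

lemma finite_measure_circle: "finite_measure circle_measure"
proof
  have "emeasure circle_measure UNIV = emeasure (uniform_measure lborel {0..2 * pi}) UNIV"
    unfolding circle_measure_def
    by (subst emeasure_distr) (auto simp: cis_measurable measurable_cong_sets[OF sets_uniform_measure refl])
  also have "\<dots> \<noteq> \<infinity>"
    by (simp add: emeasure_uniform_measure ennreal_divide_eq_top_iff)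
  finally show "emeasure circle_measure (space circle_measure) \<noteq> \<infinity>" by simp
qed

lemma integral_circle:
  fixes f :: "complex \<Rightarrow> 'b::{banach, second_countable_topology}"
  assumes [measurable]: "f \<in> borel_measurable borel"
  shows "integral\<^sup>L circle_measure f = (LINT t:{0..2*pi}|lborel. f (cis t)) /\<^sub>R (2 * pi)"
proof -
  note [measurable] = cis_measurable
  have density: "uniform_measure lborel {0..2 * pi} =
      density lborel (\<lambda>t. ennreal (indicator {0..2*pi} t / (2 * pi)))"
    unfolding uniform_measure_def
    using divide_ennreal[of 1 "2 * pi"]
    by (intro density_cong AE_I2) (auto simp: indicator_def)
  have "integral\<^sup>L circle_measure f = (LINT t|uniform_measure lborel {0..2 * pi}. f (cis t))"
    unfolding circle_measure_def
    by (rule integral_distr) (auto simp: measurable_cong_sets[OF sets_uniform_measure refl])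
  also have "\<dots> = (LINT t|lborel. (indicator {0..2*pi} t / (2 * pi)) *\<^sub>R f (cis t))"
    unfolding density by (rule integral_density) auto
  also have "\<dots> = (LINT t:{0..2*pi}|lborel. f (cis t)) /\<^sub>R (2 * pi)"
    unfolding set_lebesgue_integral_def Bochner_Integration.integral_scaleR_right[symmetric]
    by (simp only: scaleR_scaleR divide_inverse mult.commute)
  finally show ?thesis .
qed

lemma integral_circle_monomial:
  "(LINT \<omega>|circle_measure. \<omega> ^ m * cnj \<omega> ^ n) = of_bool (m = n)"
proof -
  define k where "k = int m - int n"
  have "(LINT \<omega>|circle_measure. \<omega> ^ m * cnj \<omega> ^ n) =
      (LINT t:{0..2*pi}|lborel. cis t ^ m * cnj (cis t) ^ n) /\<^sub>R (2 * pi)"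
    by (rule integral_circle) (intro borel_measurable_continuous_onI continuous_intros)
  also have "(\<lambda>t. cis t ^ m * cnj (cis t) ^ n) = (\<lambda>t. cis (of_int k * t))"
    by (rule ext) (simp add: k_def cis_cnj Complex.DeMoivre cis_mult algebra_simps)
  also have "(LINT t:{0..2*pi}|lborel. cis (of_int k * t)) = of_bool (k = 0) * (2 * pi)"
  proof (cases "k = 0")
    case True
    then show ?thesis by (simp add: set_lebesgue_integral_def scaleR_conv_of_real)
  next
    case False
    let ?F = "\<lambda>t. cis (of_int k * t) / (\<i> * of_int k)"
    have "(LINT t|lborel. indicator {0..2*pi} t *\<^sub>R cis (of_int k * t)) = ?F (2 * pi) - ?F 0"
    proof (rule integral_FTC_Icc)
      fix t :: real
      show "(?F has_vector_derivative cis (of_int k * t)) (at t within {0..2 * pi})"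
        using False unfolding has_vector_derivative_def
        by (auto intro!: derivative_eq_intros simp: scaleR_conv_of_real fun_eq_iff complex_eq_iff)
    qed (auto intro!: continuous_intros)
    also have "cis (of_int k * (2 * pi)) = 1"
      using cis_multiple_2pi[of "of_int k"] by (simp add: mult_ac)
    finally show ?thesis using False by (simp add: set_lebesgue_integral_def)
  qed
  finally show ?thesis by (simp add: k_def scaleR_conv_of_real)
qed

lemma L2_const_circle: "(\<lambda>\<omega>. u) \<in> L2 circle_measure"
  using finite_measure.integrable_const[OF finite_measure_circle] by (simp add: L2_def)

lemma circle_scalar_L2:
  fixes f :: "complex \<Rightarrow> complex ^ 'r::finite"
  assumes "f \<in> L2 circle_measure"
  shows "(\<lambda>\<omega>. \<omega> ^ k *s f \<omega>) \<in> L2 circle_measure"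
proof (rule L2_dominated[OF assms])
  show "(\<lambda>\<omega>. \<omega> ^ k *s f \<omega>) \<in> borel_measurable circle_measure"
    using L2_measurable[OF assms]
    by (intro L2_borel_measurable_bilinear[OF bounded_bilinear_vector_scalar_mult])
       (auto simp: measurable_cong_sets[OF circle_measure_simps(1) refl])
  show "AE \<omega> in circle_measure. norm (\<omega> ^ k *s f \<omega>) \<le> 1 * norm (f \<omega>)"
    using AE_circle by eventually_elim (simp add: norm_vector_scalar_mult norm_power)
qed

lemma hardy_polynomial_L2:
  "(\<lambda>\<omega>. \<Sum>k\<in>A. \<omega> ^ k *s c k) \<in> L2 circle_measure"
  by (intro L2_sum circle_scalar_L2 L2_const_circle)

lemma hardy_inner_polynomial:
  assumes "finite A"
  shows "hardy_inner (\<lambda>\<omega>. \<Sum>k\<in>A. \<omega> ^ k *s c k) (\<lambda>\<omega>. \<Sum>k\<in>A. \<omega> ^ k *s d k) = (\<Sum>k\<in>A. vec_inner (c k) (d k))"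
proof -
  interpret bounded_bilinear vec_inner by (rule bounded_bilinear_vec_inner)
  have mono: "(LINT \<omega>|circle_measure. vec_inner (\<omega> ^ k *s u) (\<omega> ^ l *s v)) = of_bool (k = l) * vec_inner u v"
    for k l and u v :: "complex ^ 'a"
    using integral_circle_monomial[of k l] by (simp add: vec_inner_scalar)
  have int: "integrable circle_measure (\<lambda>\<omega>. vec_inner (\<omega> ^ k *s u) (\<omega> ^ l *s v))"
    for k l and u v :: "complex ^ 'a"
    by (intro L2_integrable_bilinear[OF bounded_bilinear_vec_inner] circle_scalar_L2 L2_const_circle)
  have "hardy_inner (\<lambda>\<omega>. \<Sum>k\<in>A. \<omega> ^ k *s c k) (\<lambda>\<omega>. \<Sum>k\<in>A. \<omega> ^ k *s d k) =
      (\<Sum>l\<in>A. \<Sum>k\<in>A. of_bool (k = l) * vec_inner (c k) (d l))"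
    unfolding hardy_inner_def sum_left sum_right
    by (simp add: Bochner_Integration.integral_sum int mono)
  also have "\<dots> = (\<Sum>k\<in>A. vec_inner (c k) (d k))"
    using assms by (simp add: of_bool_def if_distrib[of "\<lambda>x. x * _"] cong: if_cong)
  finally show ?thesis .
qed

lemma hardy_inner_self: "hardy_inner f f = of_real (L2_normsq circle_measure f)"
  unfolding hardy_inner_def vec_inner_self L2_normsq_def by (rule integral_complex_of_real)

lemma hardy_polynomial_normsq:
  assumes "finite A"
  shows "L2_normsq circle_measure (\<lambda>\<omega>. \<Sum>k\<in>A. \<omega> ^ k *s c k) = (\<Sum>k\<in>A. (norm (c k))\<^sup>2)"
proof -
  have "complex_of_real (L2_normsq circle_measure (\<lambda>\<omega>. \<Sum>k\<in>A. \<omega> ^ k *s c k)) = of_real (\<Sum>k\<in>A. (norm (c k))\<^sup>2)"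
    unfolding hardy_inner_self[symmetric] hardy_inner_polynomial[OF assms] vec_inner_self by simp
  then show ?thesis by (simp only: of_real_eq_iff)
qed

lemma hardy_series_iff:
  "hardy_series c h \<longleftrightarrow> h \<in> L2 circle_measure \<and>
     (\<lambda>N. L2_seminorm circle_measure (\<lambda>\<omega>. h \<omega> - (\<Sum>k<N. \<omega> ^ k *s c k))) \<longlonglongrightarrow> 0"
proof -
  have "(\<lambda>N. sqrt (a N)) \<longlonglongrightarrow> 0 \<longleftrightarrow> a \<longlonglongrightarrow> 0" if "\<And>N. a N \<ge> 0" for a :: "nat \<Rightarrow> real"
    using tendsto_real_sqrt[of a 0 sequentially] tendsto_power[of "\<lambda>N. sqrt (a N)" 0 sequentially 2] that
    by auto
  from this[of "\<lambda>N. L2_normsq circle_measure (\<lambda>\<omega>. h \<omega> - (\<Sum>k<N. \<omega> ^ k *s c k))", OF L2_normsq_nonneg]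
  show ?thesis
    unfolding hardy_series_def L2_seminorm_def by simp
qed

text \<open>The Riesz-Fischer theorem: the partial sums are Cauchy by orthogonality of the powers.\<close>

lemma hardy_series_exists:
  fixes c :: "nat \<Rightarrow> complex ^ 'r::finite"
  assumes "summable (\<lambda>k. (norm (c k))\<^sup>2)"
  shows "\<exists>h. hardy_series c h"
proof -
  define S where "S N \<omega> = (\<Sum>k<N. \<omega> ^ k *s c k)" for N \<omega>
  have S: "S N \<in> L2 circle_measure" for N
    unfolding S_def by (rule hardy_polynomial_L2)
  have S_diff: "L2_normsq circle_measure (\<lambda>\<omega>. S n \<omega> - S m \<omega>) = (\<Sum>k\<in>{m..<n}. (norm (c k))\<^sup>2)" if "m \<le> n" for m n
  proof -
    have "S n \<omega> - S m \<omega> = (\<Sum>k\<in>{m..<n}. \<omega> ^ k *s c k)" for \<omega>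
      unfolding S_def lessThan_atLeast0 using that by (intro sum_diff_nat_ivl) auto
    then show ?thesis using hardy_polynomial_normsq[of "{m..<n}" c] by simp
  qed
  have "\<exists>N. \<forall>m\<ge>N. \<forall>n\<ge>N. L2_seminorm circle_measure (\<lambda>\<omega>. S m \<omega> - S n \<omega>) \<le> e" if "e > 0" for e
  proof -
    have "e\<^sup>2 > 0" using that by simp
    from summable_Cauchy[THEN iffD1, OF assms, rule_format, OF this]
    obtain N where N: "\<And>m n. m \<ge> N \<Longrightarrow> norm (\<Sum>k\<in>{m..<n}. (norm (c k))\<^sup>2) < e\<^sup>2" by blast
    have le: "L2_seminorm circle_measure (\<lambda>\<omega>. S n \<omega> - S m \<omega>) \<le> e" if "m \<ge> N" "m \<le> n" for m n
    proof -
      have "L2_normsq circle_measure (\<lambda>\<omega>. S n \<omega> - S m \<omega>) \<le> e\<^sup>2"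
        using N[OF that(1), of n] by (simp add: S_diff[OF that(2)] sum_nonneg)
      then show ?thesis
        unfolding L2_seminorm_def using \<open>e > 0\<close> by (simp add: real_le_lsqrt)
    qed
    have "L2_seminorm circle_measure (\<lambda>\<omega>. S m \<omega> - S n \<omega>) \<le> e" if "m \<ge> N" "n \<ge> N" for m n
      using le[of m n] le[of n m] that L2_seminorm_commute[of circle_measure "S m" "S n"]
      by (cases "m \<le> n") auto
    then show ?thesis by blast
  qed
  from L2_complete[OF S this] show ?thesis
    by (auto simp: hardy_series_iff S_def)
qed

lemma hardy_series_hardy_sum:
  assumes "summable (\<lambda>k. (norm (c k))\<^sup>2)"
  shows "hardy_series c (hardy_sum c)"
proof -
  have "\<exists>h. h \<in> hardy_space \<and> hardy_series c h"
    using hardy_series_exists[OF assms] assms by (auto simp: hardy_space_def)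
  then show ?thesis
    unfolding hardy_sum_def by (rule someI2_ex) simp
qed

lemma hardy_series_inner:
  assumes "hardy_series c f" "hardy_series d g"
  shows "(\<lambda>k. vec_inner (c k) (d k)) sums hardy_inner f g"
proof -
  have "(\<lambda>N. hardy_inner (\<lambda>\<omega>. \<Sum>k<N. \<omega> ^ k *s c k) (\<lambda>\<omega>. \<Sum>k<N. \<omega> ^ k *s d k)) \<longlonglongrightarrow> hardy_inner f g"
    unfolding hardy_inner_def
    using assms by (intro tendsto_L2_bilinear[OF bounded_bilinear_vec_inner] hardy_polynomial_L2)
      (auto simp: hardy_series_iff)
  then show ?thesis
    by (simp add: hardy_inner_polynomial sums_def)
qed

text \<open>The coefficients after multiplication of a power series by \<open>\<omega>\<^sup>m\<close>.\<close>

definition delay :: "nat \<Rightarrow> (nat \<Rightarrow> 'a::zero) \<Rightarrow> nat \<Rightarrow> 'a" where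
  "delay m c k = (if k < m then 0 else c (k - m))"

lemma hardy_series_delay:
  assumes "hardy_series c h"
  shows "hardy_series (delay m c) (\<lambda>\<omega>. \<omega> ^ m *s h \<omega>)"
  unfolding hardy_series_iff
proof
  from assms have h: "h \<in> L2 circle_measure"
    and lim: "(\<lambda>N. L2_seminorm circle_measure (\<lambda>\<omega>. h \<omega> - (\<Sum>k<N. \<omega> ^ k *s c k))) \<longlonglongrightarrow> 0"
    by (auto simp: hardy_series_iff)
  show "(\<lambda>\<omega>. \<omega> ^ m *s h \<omega>) \<in> L2 circle_measure"
    by (rule circle_scalar_L2[OF h])
  have "L2_seminorm circle_measure (\<lambda>\<omega>. \<omega> ^ m *s h \<omega> - (\<Sum>k<N + m. \<omega> ^ k *s delay m c k)) =
      L2_seminorm circle_measure (\<lambda>\<omega>. h \<omega> - (\<Sum>k<N. \<omega> ^ k *s c k))" for N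
  proof -
    let ?D = "\<lambda>\<omega>. h \<omega> - (\<Sum>k<N. \<omega> ^ k *s c k)"
    have D: "?D \<in> L2 circle_measure"
      by (intro L2_diff h hardy_polynomial_L2)
    have "\<omega> ^ m *s h \<omega> - (\<Sum>k<N + m. \<omega> ^ k *s delay m c k) = \<omega> ^ m *s ?D \<omega>" for \<omega>
    proof -
      have "(\<Sum>k<N + m. \<omega> ^ k *s delay m c k) =
          (\<Sum>k<m. \<omega> ^ k *s delay m c k) + (\<Sum>k=m..<m+N. \<omega> ^ k *s delay m c k)"
        by (subst add.commute, simp only: lessThan_atLeast0) (rule sum.atLeastLessThan_concat[symmetric]; simp)
      also have "(\<Sum>k<m. \<omega> ^ k *s delay m c k) = 0"
        by (intro sum.neutral) (auto simp: delay_def)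
      also have "(\<Sum>k=m..<m+N. \<omega> ^ k *s delay m c k) = (\<Sum>k=0..<N. \<omega> ^ (k + m) *s delay m c (k + m))"
        using sum.shift_bounds_nat_ivl[of "\<lambda>k. \<omega> ^ k *s delay m c k" 0 m N] by (simp add: add.commute)
      also have "\<dots> = \<omega> ^ m *s (\<Sum>k<N. \<omega> ^ k *s c k)"
        by (simp add: delay_def vec_eq_iff sum_distrib_left power_add mult_ac lessThan_atLeast0)
      finally show ?thesis by (simp add: vec_eq_iff right_diff_distrib)
    qed
    moreover have "L2_normsq circle_measure (\<lambda>\<omega>. \<omega> ^ m *s ?D \<omega>) = L2_normsq circle_measure ?D"
      unfolding L2_normsq_def
    proof (rule integral_cong_AE)
      show "AE \<omega> in circle_measure. (norm (\<omega> ^ m *s ?D \<omega>))\<^sup>2 = (norm (?D \<omega>))\<^sup>2"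
        using AE_circle by eventually_elim (subst norm_vector_scalar_mult, simp add: norm_power)
    qed (use L2_integrable[OF circle_scalar_L2[OF D]] L2_integrable[OF D] in auto)
    ultimately show ?thesis by (simp add: L2_seminorm_def)
  qed
  then have "(\<lambda>N. L2_seminorm circle_measure (\<lambda>\<omega>. \<omega> ^ m *s h \<omega> - (\<Sum>k<N + m. \<omega> ^ k *s delay m c k))) \<longlonglongrightarrow> 0"
    using lim by (simp only:)
  then show "(\<lambda>N. L2_seminorm circle_measure (\<lambda>\<omega>. \<omega> ^ m *s h \<omega> - (\<Sum>k<N. \<omega> ^ k *s delay m c k))) \<longlonglongrightarrow> 0"
    by (rule LIMSEQ_offset)
qed

section \<open>The Gram matrix of a wavelet system\<close>

lemma haar_vec_nth: "haar_vec \<psi> m $ i = L2R_inner (\<psi> i) (haar m)"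
  by (simp add: haar_vec_def)

lemma floor_log_dyadic: "q < 2 ^ p \<Longrightarrow> floor_log (2 ^ p + q) = p"
  by (intro floor_log_eqI) auto

text \<open>
  Bessel's inequality, as the Haar basis of \<open>L\<^sup>2[0,1]\<close> without its \<open>0\<close>-th member is a subfamily of
  the Haar system on the line.
\<close>

lemma haar_vec_norm_summable:
  fixes \<psi> :: "'r::finite \<Rightarrow> real \<Rightarrow> complex"
  assumes "\<And>i. \<psi> i \<in> L2_unit"
  shows "(\<lambda>m. (norm (haar_vec \<psi> m))\<^sup>2) summable_on A"
proof -
  define pos where "pos m = (int (floor_log m), int (m - 2 ^ floor_log m))" for m :: nat
  have split: "m = 2 ^ floor_log m + (m - 2 ^ floor_log m) \<and> m - 2 ^ floor_log m < 2 ^ floor_log m"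
    if "m \<ge> 1" for m
    using floor_log_exp2_le[of m] floor_log_exp2_gt[of m] that by linarith
  have "inj_on pos {1..}"
  proof (rule inj_onI)
    fix m n assume "m \<in> {1..}" "n \<in> {1..}" "pos m = pos n"
    then show "m = n" using split[of m] split[of n] by (auto simp: pos_def)
  qed
  have 1: "(\<lambda>m. (cmod (L2R_inner (\<psi> i) (haar m)))\<^sup>2) summable_on {1..}" for i
  proof -
    have "(\<lambda>a. (cmod (L2R_inner (\<psi> i) (case a of (K, J) \<Rightarrow> haar_wave K J)))\<^sup>2) summable_on (pos ` {1..})"
      by (rule Bessel_summable[OF orthonormal_haar L2_unit_L2[OF assms]])
    then have "((\<lambda>a. (cmod (L2R_inner (\<psi> i) (case a of (K, J) \<Rightarrow> haar_wave K J)))\<^sup>2) \<circ> pos) summable_on {1..}"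
      using summable_on_reindex[OF \<open>inj_on pos {1..}\<close>] by blast
    moreover have "haar m = haar_wave (int (floor_log m)) (int (m - 2 ^ floor_log m))" if "m \<ge> 1" for m
      using haar_eq_haar_wave[of "m - 2 ^ floor_log m" "floor_log m"] split[OF that] by simp
    ultimately show ?thesis
      by (subst summable_on_cong[where g = "(\<lambda>a. (cmod (L2R_inner (\<psi> i) (case a of (K, J) \<Rightarrow> haar_wave K J)))\<^sup>2) \<circ> pos"])
         (auto simp: pos_def)
  qed
  have "((\<lambda>m. \<Sum>i\<in>UNIV. (cmod (L2R_inner (\<psi> i) (haar m)))\<^sup>2) has_sum
      (\<Sum>i\<in>UNIV. infsum (\<lambda>m. (cmod (L2R_inner (\<psi> i) (haar m)))\<^sup>2) {1..})) {1..}"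
    by (intro has_sum_sum has_sum_infsum 1)
  then have "(\<lambda>m. \<Sum>i\<in>UNIV. (cmod (L2R_inner (\<psi> i) (haar m)))\<^sup>2) summable_on {1..}"
    by (rule has_sum_imp_summable)
  moreover have "(norm (haar_vec \<psi> m))\<^sup>2 = (\<Sum>i\<in>UNIV. (cmod (L2R_inner (\<psi> i) (haar m)))\<^sup>2)" for m
    by (simp add: norm_vec_def L2_set_def sum_nonneg haar_vec_nth)
  ultimately have "(\<lambda>m. (norm (haar_vec \<psi> m))\<^sup>2) summable_on {1..}"
    by simp
  then have "(\<lambda>m. (norm (haar_vec \<psi> m))\<^sup>2) summable_on (insert 0 {1..})"
    by (simp add: summable_on_insert_iff)
  then show ?thesis
    by (rule summable_on_subset_banach) (auto simp: Suc_le_eq)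
qed

text \<open>
  The place in the Haar basis of \<open>L\<^sup>2[0,1]\<close> of the Haar function \<open>(K, J)\<close> after rescaling its
  dyadic ancestor of level \<open>k \<le> K\<close> to \<open>[0,1)\<close>.
\<close>

definition index_below :: "int \<Rightarrow> int \<Rightarrow> int \<Rightarrow> nat" where
  "index_below K J k = 2 ^ nat (K - k) + nat (J mod 2 ^ nat (K - k))"

text \<open>
  The contribution of a common dyadic ancestor of level \<open>k\<close> to the inner product of the rows
  \<open>(K, J)\<close> and \<open>(K', J')\<close> of the matrix of Haar coefficients of the wavelet system.
\<close>

definition gram_term ::
    "('r::finite \<Rightarrow> real \<Rightarrow> complex) \<Rightarrow> int \<Rightarrow> int \<Rightarrow> int \<Rightarrow> int \<Rightarrow> int \<Rightarrow> complex" where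
  "gram_term \<psi> K J K' J' k =
     (if k \<le> K \<and> k \<le> K' \<and> J div 2 ^ nat (K - k) = J' div 2 ^ nat (K' - k)
      then vec_inner (haar_vec \<psi> (index_below K' J' k)) (haar_vec \<psi> (index_below K J k)) else 0)"

definition gram :: "('r::finite \<Rightarrow> real \<Rightarrow> complex) \<Rightarrow> int \<Rightarrow> int \<Rightarrow> int \<Rightarrow> int \<Rightarrow> complex" where
  "gram \<psi> K J K' J' = infsum (gram_term \<psi> K J K' J') UNIV"

lemma floor_log_index_below: "floor_log (index_below K J k) = nat (K - k)"
  unfolding index_below_def by (intro floor_log_dyadic) (simp add: nat_less_iff)

lemma inj_on_index_below: "inj_on (index_below K J) {..K}"
proof (rule inj_onI)
  fix k k' assume "k \<in> {..K}" "k' \<in> {..K}" "index_below K J k = index_below K J k'"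
  then show "k = k'"
    using floor_log_index_below[of K J k] floor_log_index_below[of K J k'] by auto
qed

lemma index_below_norm_summable:
  assumes "\<And>i. \<psi> i \<in> L2_unit" "A \<subseteq> {..K}"
  shows "(\<lambda>k. (norm (haar_vec \<psi> (index_below K J k)))\<^sup>2) summable_on A"
  using summable_on_reindex[OF inj_on_subset[OF inj_on_index_below assms(2)], of "\<lambda>m. (norm (haar_vec \<psi> m))\<^sup>2" J]
    haar_vec_norm_summable[of \<psi>, OF assms(1)]
  by (simp add: o_def)

lemma norm_gram_term_le:
  "cmod (gram_term \<psi> K J K' J' k) \<le>
    (of_bool (k \<le> K) * (norm (haar_vec \<psi> (index_below K J k)))\<^sup>2 +
     of_bool (k \<le> K') * (norm (haar_vec \<psi> (index_below K' J' k)))\<^sup>2) / 2"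
  using norm_vec_inner_le[of "haar_vec \<psi> (index_below K' J' k)" "haar_vec \<psi> (index_below K J k)"]
  by (auto simp: gram_term_def)

lemma index_below_norm_summable_UNIV:
  assumes "\<And>i. \<psi> i \<in> L2_unit"
  shows "(\<lambda>k. of_bool (k \<le> K) * (norm (haar_vec \<psi> (index_below K J k)))\<^sup>2) summable_on UNIV"
  using index_below_norm_summable[of \<psi> "{..K}" K J, OF assms]
  by (subst summable_on_cong_neutral[where T = "{..K}" and g = "\<lambda>k. (norm (haar_vec \<psi> (index_below K J k)))\<^sup>2"]) auto

lemma gram_term_summable:
  assumes "\<And>i. \<psi> i \<in> L2_unit"
  shows "gram_term \<psi> K J K' J' summable_on A"
proof -
  let ?b = "\<lambda>k. (of_bool (k \<le> K) * (norm (haar_vec \<psi> (index_below K J k)))\<^sup>2 +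
     of_bool (k \<le> K') * (norm (haar_vec \<psi> (index_below K' J' k)))\<^sup>2) / 2"
  have "?b summable_on UNIV"
    unfolding divide_inverse
    by (intro summable_on_cmult_left summable_on_add index_below_norm_summable_UNIV assms)
  then have "gram_term \<psi> K J K' J' summable_on UNIV"
    by (rule abs_summable_summable[OF summable_on_comparison_test[OF _ norm_gram_term_le norm_ge_zero]])
  then show ?thesis by (rule summable_on_subset_banach) simp
qed

lemma haar_wave_inner_generator:
  assumes "\<And>i. \<psi> i \<in> L2_unit" "haar_vec \<psi> 0 = 0"
  shows "L2R_inner (haar_wave K J) (wave k j (\<psi> i)) =
    (if k \<le> K \<and> j = J div 2 ^ nat (K - k) then cnj (haar_vec \<psi> (index_below K J k) $ i) else 0)"
proof -
  have "L2R_inner (\<psi> i) (haar 0) = 0"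
    using arg_cong[OF assms(2), of "\<lambda>v. v $ i"] by (simp add: haar_vec_nth)
  then show ?thesis
    by (subst haar_wave_inner_wave[OF assms(1)]) (auto simp: index_below_def haar_vec_nth)
qed

text \<open>
  For fixed generator and level \<open>k\<close> at most one translate meets a given Haar function of level
  \<open>\<ge> k\<close>, namely the one living on the dyadic interval of level \<open>k\<close> that contains its support.
\<close>

lemma has_sum_gram:
  fixes \<psi> :: "'r::finite \<Rightarrow> real \<Rightarrow> complex"
  assumes \<psi>: "\<And>i. \<psi> i \<in> L2_unit" "haar_vec \<psi> 0 = 0"
  shows "((\<lambda>(i, k, j). L2R_inner (haar_wave K J) (wave k j (\<psi> i)) *
      cnj (L2R_inner (haar_wave K' J') (wave k j (\<psi> i)))) has_sum gram \<psi> K J K' J')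
    (UNIV :: ('r \<times> int \<times> int) set)"
proof -
  let ?F = "\<lambda>(i, k, j). L2R_inner (haar_wave K J) (wave k j (\<psi> i)) *
      cnj (L2R_inner (haar_wave K' J') (wave k j (\<psi> i)))"
  define H where "H i k = (if k \<le> K \<and> k \<le> K' \<and> J div 2 ^ nat (K - k) = J' div 2 ^ nat (K' - k)
    then haar_vec \<psi> (index_below K' J' k) $ i * cnj (haar_vec \<psi> (index_below K J k) $ i) else 0)" for i k
  define pos where "pos i k = (i, k, J div 2 ^ nat (K - k))" for i :: 'r and k
  have F_pos: "?F \<circ> pos i = H i" for i
    by (auto simp: pos_def H_def haar_wave_inner_generator[OF \<psi>])
  have H_sum: "(\<Sum>i\<in>UNIV. H i k) = gram_term \<psi> K J K' J' k" for k
    by (auto simp: H_def gram_term_def vec_inner_def)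
  have H_summable: "H i summable_on UNIV" for i
  proof -
    let ?b = "\<lambda>k. (of_bool (k \<le> K) * (norm (haar_vec \<psi> (index_below K J k)))\<^sup>2 +
       of_bool (k \<le> K') * (norm (haar_vec \<psi> (index_below K' J' k)))\<^sup>2) / 2"
    have "?b summable_on UNIV"
      unfolding divide_inverse
      by (intro summable_on_cmult_left summable_on_add index_below_norm_summable_UNIV \<psi>(1))
    moreover have "norm (H i k) \<le> ?b k" for k
    proof -
      have *: "cmod (u $ i * cnj (v $ i)) \<le> ((norm v)\<^sup>2 + (norm u)\<^sup>2) / 2" for u v :: "complex ^ 'r"
      proof -
        have "cmod (u $ i * cnj (v $ i)) \<le> norm u * norm v"
          by (auto simp: norm_mult intro!: mult_mono Finite_Cartesian_Product.norm_nth_le)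
        also have "\<dots> \<le> ((norm v)\<^sup>2 + (norm u)\<^sup>2) / 2"
          using sum_squares_bound[of "norm u" "norm v"] by simp
        finally show ?thesis .
      qed
      show ?thesis using * by (simp add: H_def)
    qed
    ultimately show ?thesis
      by (rule abs_summable_summable[OF summable_on_comparison_test[OF _ _ norm_ge_zero]])
  qed
  have "(?F has_sum infsum (H i) UNIV) (range (pos i))" for i
  proof -
    have "inj (pos i)" by (auto simp: inj_def pos_def)
    then show ?thesis
      unfolding has_sum_reindex[OF \<open>inj (pos i)\<close>] F_pos by (intro has_sum_infsum H_summable)
  qed
  then have "(?F has_sum (\<Sum>i\<in>UNIV. infsum (H i) UNIV)) (\<Union>i\<in>UNIV. range (pos i))"
    by (intro sum_has_sum) (auto simp: pos_def)
  moreover have "(\<Sum>i\<in>UNIV. infsum (H i) UNIV) = gram \<psi> K J K' J'"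
  proof (rule has_sum_unique)
    show "((\<lambda>k. \<Sum>i\<in>UNIV. H i k) has_sum (\<Sum>i\<in>UNIV. infsum (H i) UNIV)) UNIV"
      by (intro has_sum_sum has_sum_infsum H_summable)
    show "((\<lambda>k. \<Sum>i\<in>UNIV. H i k) has_sum gram \<psi> K J K' J') UNIV"
      unfolding H_sum gram_def by (intro has_sum_infsum gram_term_summable \<psi>(1))
  qed
  moreover have "?F x = 0" if "x \<notin> (\<Union>i\<in>UNIV. range (pos i))" for x
  proof -
    obtain i k j where x: "x = (i, k, j)" by (cases x)
    have "j \<noteq> J div 2 ^ nat (K - k)"
      using that unfolding x pos_def by blast
    then show ?thesis
      by (simp add: x haar_wave_inner_generator[OF \<psi>])
  qed
  ultimately show ?thesis
    by (subst has_sum_cong_neutral[where S = UNIV and T = "\<Union>i\<in>UNIV. range (pos i)" and g = ?F]) auto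
qed

text \<open>
  The copies of the generators at level \<open>\<kappa> \<ge> 0\<close> inside \<open>[0,1]\<close> contribute the same amount
  \<open>\<Sum>\<^sub>i |\<integral> \<psi>\<^sub>i|\<^sup>2\<close> to the frame sum of \<open>\<chi>\<^bsub>[0,1)\<^esub>\<close>, for every \<open>\<kappa>\<close>.
\<close>

lemma tight_frame_imp_mean_zero:
  fixes \<psi> :: "'r::finite \<Rightarrow> real \<Rightarrow> complex"
  assumes \<psi>: "\<And>i. \<psi> i \<in> L2_unit" and tight: "tight_frame \<psi> B"
  shows "haar_vec \<psi> 0 = 0"
proof -
  have "haar_vec \<psi> 0 $ i = 0" for i
  proof -
    define v where "v = haar_vec \<psi> 0 $ i"
    define t where "t = (\<lambda>(i, k, j). (cmod (L2R_inner (haar 0) (wave k j (\<psi> i))))\<^sup>2)"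
    have sum: "(t has_sum (B * L2_normsq lborel (haar 0))) UNIV"
      using tight haar_L2 by (auto simp: tight_frame_def wave_def t_def)
    have t_eq: "t (i, int \<kappa>, j) = (cmod v)\<^sup>2 / 2 ^ \<kappa>" if j: "j \<in> {0..<2 ^ \<kappa>}" for \<kappa> j
    proof -
      let ?c = "complex_of_real (2 powr (- of_int (int \<kappa>) / 2))"
      have "L2R_inner (haar 0) (wave (int \<kappa>) j (\<psi> i)) = L2R_inner (\<lambda>y. ?c * haar 0 y) (\<psi> i)"
        unfolding L2R_inner_wave_right
      proof (rule L2R_inner_cong_unit[OF \<psi>])
        fix y :: real assume y: "y \<in> {0..<1}"
        have "2 powr (- of_int (int \<kappa>)) = 1 / (2::real) ^ \<kappa>"
          by (simp add: powr_minus_divide powr_realpow)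
        moreover have "0 \<le> y + of_int j" using y j by simp
        moreover have "y + of_int j < 2 ^ \<kappa>"
        proof -
          have "j + 1 \<le> 2 ^ \<kappa>" using j by simp
          then have "of_int (j + 1) \<le> (of_int (2 ^ \<kappa>) :: real)" by (simp only: of_int_le_iff)
          then show ?thesis using y by simp
        qed
        ultimately have "2 powr (- of_int (int \<kappa>)) * (y + of_int j) \<in> {0..<1}"
          by simp
        then show "?c * haar 0 (2 powr (- of_int (int \<kappa>)) * (y + of_int j)) = ?c * haar 0 y"
          using y by (simp only: haar_zero indicator_simps)
      qed (auto simp: haar_zero)
      also have "\<dots> = ?c * cnj v"
        by (simp add: L2R_inner_cmult_left v_def haar_vec_nth cnj_L2R_inner)
      finally have "t (i, int \<kappa>, j) = (2 powr (- of_int (int \<kappa>) / 2))\<^sup>2 * (cmod v)\<^sup>2"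
        by (simp add: t_def norm_mult power_mult_distrib)
      also have "(2 powr (- of_int (int \<kappa>) / 2))\<^sup>2 = 1 / (2::real) ^ \<kappa>"
        by (simp add: power2_eq_square powr_minus_divide powr_realpow flip: powr_add)
      finally show ?thesis by simp
    qed
    have le: "real N * (cmod v)\<^sup>2 \<le> B * L2_normsq lborel (haar 0)" for N
    proof -
      let ?S = "SIGMA \<kappa>:{..<N}. {0..<2 ^ \<kappa> :: int}"
      let ?f = "\<lambda>(\<kappa>, j). (i, int \<kappa>, j)"
      have "real N * (cmod v)\<^sup>2 = (\<Sum>\<kappa><N. \<Sum>j\<in>{0..<2 ^ \<kappa> :: int}. (cmod v)\<^sup>2 / 2 ^ \<kappa>)"
        by (simp add: nat_power_eq)
      also have "\<dots> = (\<Sum>(\<kappa>, j)\<in>?S. (cmod v)\<^sup>2 / 2 ^ \<kappa>)"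
        by (subst sum.Sigma) auto
      also have "\<dots> = (\<Sum>x\<in>?S. t (?f x))"
        by (intro sum.cong) (auto simp: t_eq)
      also have "\<dots> = sum t (?f ` ?S)"
        by (subst sum.reindex) (auto simp: inj_on_def)
      also have "\<dots> \<le> B * L2_normsq lborel (haar 0)"
        by (rule finite_sum_le_has_sum[OF sum]) (auto simp: t_def)
      finally show ?thesis .
    qed
    show "haar_vec \<psi> 0 $ i = 0"
    proof (rule ccontr)
      assume "haar_vec \<psi> 0 $ i \<noteq> 0"
      then have "(cmod v)\<^sup>2 > 0" by (simp add: v_def)
      from reals_Archimedean3[OF this, rule_format, of "B * L2_normsq lborel (haar 0)"] le show False
        by (auto simp: not_less[symmetric])
    qed
  qed
  then show ?thesis by (simp add: vec_eq_iff)
qed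

text \<open>
  The tight frame identity needs to be tested, in sesquilinear form, only on the Haar basis, where
  the frame sums are the Gram sums.
\<close>

lemma tight_frame_iff_gram:
  fixes \<psi> :: "'r::finite \<Rightarrow> real \<Rightarrow> complex"
  assumes \<psi>: "\<And>i. \<psi> i \<in> L2_unit" and "B > 0"
  shows "tight_frame \<psi> B \<longleftrightarrow> haar_vec \<psi> 0 = 0 \<and>
    (\<forall>K J K' J'. gram \<psi> K J K' J' = of_real B * of_bool (K = K' \<and> J = J'))"
proof (cases "haar_vec \<psi> 0 = 0")
  case True
  let ?e = "\<lambda>(i, k, j). wave k j (\<psi> i)"
  let ?h = "\<lambda>(K, J). haar_wave K J"
  have "tight_frame \<psi> B \<longleftrightarrow>
      (\<forall>f\<in>L2 lborel. ((\<lambda>a. (cmod (L2R_inner f (?e a)))\<^sup>2) has_sum (B * L2_normsq lborel f)) UNIV)"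
    unfolding tight_frame_def
    by (intro ball_cong refl arg_cong[where f = "\<lambda>F. (F has_sum _) UNIV"]) (auto simp: wave_def)
  also have "\<dots> \<longleftrightarrow> (\<forall>b b'. ((\<lambda>a. L2R_inner (?h b) (?e a) * cnj (L2R_inner (?h b') (?e a))) has_sum
      (of_real B * L2R_inner (?h b) (?h b'))) UNIV)"
    using \<open>B > 0\<close> haar_dense
    by (intro tight_frame_iff_dense) (auto intro: wave_L2 L2_unit_L2 \<psi> haar_wavelet_L2)
  also have "\<dots> \<longleftrightarrow> (\<forall>K J K' J'. gram \<psi> K J K' J' = of_real B * of_bool (K = K' \<and> J = J'))"
  proof -
    have "((\<lambda>a. L2R_inner (haar_wave K J) (?e a) * cnj (L2R_inner (haar_wave K' J') (?e a))) has_sum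
        (of_real B * L2R_inner (haar_wave K J) (haar_wave K' J'))) UNIV \<longleftrightarrow>
      gram \<psi> K J K' J' = of_real B * of_bool (K = K' \<and> J = J')" for K J K' J'
    proof -
      have inner: "L2R_inner (haar_wave K J) (haar_wave K' J') = of_bool (K = K' \<and> J = J')"
        using orthonormal_haar[unfolded orthonormal_def, THEN conjunct2, rule_format, of "(K, J)" "(K', J')"]
        by simp
      have hs: "((\<lambda>a. L2R_inner (haar_wave K J) (?e a) * cnj (L2R_inner (haar_wave K' J') (?e a))) has_sum
          gram \<psi> K J K' J') UNIV"
        by (rule has_sum_cong[THEN iffD1, OF _ has_sum_gram[OF \<psi> True, of K J K' J']]) auto
      show ?thesis
        unfolding inner by (rule iffI; (drule has_sum_unique[OF hs] | drule sym), (assumption | simp only: hs))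
    qed
    then show ?thesis by simp
  qed
  finally show ?thesis using True by simp
next
  case False
  then show ?thesis using tight_frame_imp_mean_zero[of \<psi>, OF \<psi>] by blast
qed

section \<open>The Gram matrix and the Hardy space\<close>

text \<open>
  The number of binary digits, where \<open>0\<close> has none. With this convention the two cases in the
  definition of \<open>\<hh>\<^sub>l\<close> become one.
\<close>

definition bits :: "nat \<Rightarrow> nat" where
  "bits l = (if l = 0 then 0 else floor_log l + 1)"

lemma less_two_power_bits: "l < 2 ^ bits l"
  using floor_log_exp2_gt[of l] by (simp add: bits_def)

lemma floor_log_le: "l \<noteq> 0 \<Longrightarrow> 2 ^ floor_log l \<le> l"
  by (rule floor_log_exp2_le) simp

definition hardy_coeff :: "('r::finite \<Rightarrow> real \<Rightarrow> complex) \<Rightarrow> nat \<Rightarrow> nat \<Rightarrow> complex ^ 'r" where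
  "hardy_coeff \<psi> l k = haar_vec \<psi> (2 ^ (bits l + k) + l)"

lemma hardy_h_eq: "hardy_h \<psi> l = hardy_sum (hardy_coeff \<psi> l)"
proof -
  have "hardy_coeff \<psi> l = (\<lambda>k. haar_vec \<psi> (2 ^ (bits l + k) + l))"
    by (rule ext) (rule hardy_coeff_def)
  then show ?thesis by (simp add: hardy_h_def bits_def)
qed

lemma hardy_coeff_summable:
  assumes "\<And>i. \<psi> i \<in> L2_unit"
  shows "summable (\<lambda>k. (norm (hardy_coeff \<psi> l k))\<^sup>2)"
proof -
  have "inj (\<lambda>k. 2 ^ (bits l + k) + l)"
    by (auto simp: inj_def)
  from summable_on_reindex[OF this, of "\<lambda>m. (norm (haar_vec \<psi> m))\<^sup>2"]
  have "(\<lambda>k. (norm (hardy_coeff \<psi> l k))\<^sup>2) summable_on UNIV"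
    using haar_vec_norm_summable[of \<psi>, OF assms] by (simp add: o_def hardy_coeff_def)
  then show ?thesis by (rule summable_on_imp_summable)
qed

lemma gram_term_tail:
  assumes "m \<le> \<kappa>" "n \<le> \<kappa>"
  shows "gram_term \<psi> (int (bits l) - int n) (int l) (int (bits l') - int m) (int l') (- int \<kappa>) =
    vec_inner (delay m (hardy_coeff \<psi> l') \<kappa>) (delay n (hardy_coeff \<psi> l) \<kappa>)"
proof -
  have *: "nat (int (bits l) - int n - - int \<kappa>) = bits l + (\<kappa> - n)" if "n \<le> \<kappa>" for l n
    using that by simp
  have small: "int l < 2 ^ (bits l + j)" for l j
  proof -
    have "l < 2 ^ (bits l + j)"
      using less_two_power_bits[of l] by (rule less_le_trans) simp
    then have "int l < int (2 ^ (bits l + j))" by (simp only: of_nat_less_iff)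
    then show ?thesis by simp
  qed
  have div: "int l div 2 ^ (bits l + j) = 0" and mod: "int l mod 2 ^ (bits l + j) = int l" for l j
    using small[of l j] by simp_all
  show ?thesis
    unfolding gram_term_def index_below_def *[OF assms(1)] *[OF assms(2)] div mod
    using assms by (simp add: delay_def hardy_coeff_def)
qed

text \<open>
  The levels \<open>k \<le> - max m n\<close>, at which both Haar functions descend from the dyadic interval
  starting at \<open>0\<close>, make up the inner product in the Hardy space.
\<close>

lemma gram_eq_hardy_inner_plus:
  fixes \<psi> :: "'r::finite \<Rightarrow> real \<Rightarrow> complex"
  assumes \<psi>: "\<And>i. \<psi> i \<in> L2_unit"
  defines "K \<equiv> \<lambda>l n. int (bits l) - int n"
  shows "gram \<psi> (K l n) (int l) (K l' m) (int l') =
    hardy_inner (\<lambda>\<omega>. \<omega> ^ m *s hardy_h \<psi> l' \<omega>) (\<lambda>\<omega>. \<omega> ^ n *s hardy_h \<psi> l \<omega>) +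
    (\<Sum>k\<in>{- int (max m n)<..min (K l n) (K l' m)}. gram_term \<psi> (K l n) (int l) (K l' m) (int l') k)"
    (is "_ = ?hardy + sum ?g ?H")
proof -
  let ?T = "{..- int (max m n)}"
  let ?v = "\<lambda>\<kappa>. vec_inner (delay m (hardy_coeff \<psi> l') \<kappa>) (delay n (hardy_coeff \<psi> l) \<kappa>)"
  have "(?g has_sum infsum ?g ?T) ?T"
    by (intro has_sum_infsum gram_term_summable \<psi>)
  moreover have "(?g has_sum a) ?T \<longleftrightarrow> (?v has_sum a) {max m n..}" for a
  proof (rule has_sum_reindex_bij_witness[where i = "\<lambda>\<kappa>. - int \<kappa>" and j = "\<lambda>k. nat (- k)"])
    fix k assume k: "k \<in> ?T"
    have "?g (- int (nat (- k))) = ?v (nat (- k))"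
      unfolding K_def using k by (intro gram_term_tail) auto
    then show "?v (nat (- k)) = ?g k" using k by simp
  qed auto
  moreover have "(?v has_sum a) {max m n..} \<longleftrightarrow> (?v has_sum a) UNIV" for a
    by (rule has_sum_cong_neutral) (auto simp: delay_def)
  ultimately have "?v sums infsum ?g ?T"
    by (intro has_sum_imp_sums) simp
  moreover have "?v sums ?hardy"
    unfolding hardy_h_eq
    by (intro hardy_series_inner hardy_series_delay hardy_series_hardy_sum hardy_coeff_summable \<psi>)
  ultimately have "infsum ?g ?T = ?hardy"
    by (rule sums_unique2)
  then have "(?g has_sum ?hardy) ?T"
    using has_sum_infsum[OF gram_term_summable[of \<psi>, OF \<psi>], of "K l n" "int l" "K l' m" "int l'" ?T]
    by simp
  moreover have "(?g has_sum sum ?g ?H) ?H"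
    by (rule has_sum_finite) simp
  ultimately have "(?g has_sum (?hardy + sum ?g ?H)) (?T \<union> ?H)"
    by (rule has_sum_Un_disjoint) auto
  moreover have "(?g has_sum a) (?T \<union> ?H) \<longleftrightarrow> (?g has_sum a) UNIV" for a
    by (rule has_sum_cong_neutral) (auto simp: gram_term_def not_le)
  ultimately have "(?g has_sum (?hardy + sum ?g ?H)) UNIV"
    by blast
  then show ?thesis
    unfolding gram_def by (rule infsumI)
qed

lemma low_index_eq: "low_index l n = 2 ^ n + l mod 2 ^ n"
proof -
  have "(\<Sum>t<n. digit l t * 2 ^ t) = take_bit n l"
    unfolding take_bit_sum digit_def lessThan_atLeast0
    by (intro sum.cong) (auto simp: push_bit_eq_mult of_bool_def)
  then show ?thesis by (simp add: low_index_def take_bit_eq_mod)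
qed

lemma high_digits_eq:
  assumes "s \<le> floor_log l"
  shows "high_digits l s = l div 2 ^ (floor_log l - s)"
proof -
  let ?x = "l div 2 ^ (floor_log l - s)"
  have "high_digits l s = (\<Sum>t<Suc s. of_bool (bit ?x t) * 2 ^ t)"
    unfolding high_digits_def lessThan_Suc_atMost
    by (intro sum.cong) (auto simp: digit_def bit_iff_odd div_mult2_eq power_add)
  also have "\<dots> = take_bit (Suc s) ?x"
    unfolding take_bit_sum lessThan_atLeast0
    by (intro sum.cong) (auto simp: push_bit_eq_mult of_bool_def)
  also have "\<dots> = ?x"
  proof -
    have "l < 2 * 2 ^ floor_log l" by (rule floor_log_exp2_gt)
    also have "\<dots> = 2 ^ Suc s * 2 ^ (floor_log l - s)"
      using assms by (simp flip: power_add)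
    finally have "?x < 2 ^ Suc s" by (simp add: div_less_iff_less_mult)
    then show ?thesis by (rule take_bit_nat_eq_self)
  qed
  finally show ?thesis .
qed

text \<open>
  With its high digits written as a quotient and its low digits as a remainder, the sum defining
  \<open>\<beta>\<^sub>l\<^sub>,\<^sub>l\<^sub>'\<close> runs over common leading parts; for \<open>l = l'\<close> every leading part is common.
\<close>

lemma beta_eq_common_ancestors:
  fixes \<psi> :: "'r::finite \<Rightarrow> real \<Rightarrow> complex"
  assumes "l \<noteq> 0" "l' \<noteq> 0"
  defines "p \<equiv> floor_log l" and "p' \<equiv> floor_log l'"
  shows "(\<Sum>s = 0..min p p'. of_bool (l div 2 ^ (p - s) = l' div 2 ^ (p' - s)) *
      vec_inner (haar_vec \<psi> (low_index l' (p' - s))) (haar_vec \<psi> (low_index l (p - s)))) =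
    of_real B * of_bool (l = l') - beta \<psi> B l l'"
proof (cases "l = l'")
  case True
  then show ?thesis
    using assms by (simp add: beta_def Let_def vec_inner_self)
next
  case False
  have delta: "delta (int (high_digits l s) - int (high_digits l' s)) =
      of_bool (l div 2 ^ (p - s) = l' div 2 ^ (p' - s))" if "s \<in> {0..min p p'}" for s
    using that by (simp add: delta_def high_digits_eq p_def p'_def)
  have "beta \<psi> B l l' = - (\<Sum>s = 0..min p p'. delta (int (high_digits l s) - int (high_digits l' s)) *
      vec_inner (haar_vec \<psi> (low_index l' (p' - s))) (haar_vec \<psi> (low_index l (p - s))))"
    using False assms by (simp add: beta_def Let_def)
  also have "\<dots> = - (\<Sum>s = 0..min p p'. of_bool (l div 2 ^ (p - s) = l' div 2 ^ (p' - s)) *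
      vec_inner (haar_vec \<psi> (low_index l' (p' - s))) (haar_vec \<psi> (low_index l (p - s))))"
    by (intro arg_cong[where f = uminus] sum.cong refl) (simp only: delta)
  finally show ?thesis using False by simp
qed

text \<open>
  At levels above \<open>- max m n\<close>, the dyadic interval containing the support of at least one of the
  two Haar functions is not the first one, and its position is a leading part of the binary
  expansion of \<open>l\<close> or \<open>l'\<close>. If \<open>m \<noteq> n\<close> the numbers of leading digits differ for the two Haar
  functions, so that the intervals differ.
\<close>

lemma gram_head_distinct:
  assumes "n < m" and k: "- int m < k" "k \<le> int (bits l) - int n" "k \<le> int (bits l') - int m"
  shows "int l div 2 ^ nat (int (bits l) - int n - k) \<noteq> int l' div 2 ^ nat (int (bits l') - int m - k)"
proof -
  define b where "b = nat (int m + k)"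
  define e where "e = nat (int (bits l) - int n - k)"
  define e' where "e' = nat (int (bits l') - int m - k)"
  have b: "b \<ge> 1" "e' + b = bits l'" "bits l \<le> e + (b - 1)"
    using k \<open>n < m\<close> by (auto simp: b_def e_def e'_def)
  have "l < 2 ^ bits l" by (rule less_two_power_bits)
  also have "\<dots> \<le> 2 ^ (e + (b - 1))" using b(3) by (intro power_increasing) auto
  finally have "l div 2 ^ e < 2 ^ (b - 1)"
    by (simp add: div_less_iff_less_mult power_add mult.commute)
  moreover have "2 ^ (b - 1) \<le> l' div 2 ^ e'"
  proof -
    have "bits l' \<noteq> 0" using b by simp
    then have l': "l' \<noteq> 0" and "floor_log l' = e' + (b - 1)"
      using b by (auto simp: bits_def split: if_splits)
    with floor_log_le[OF l'] have "2 ^ (b - 1) * 2 ^ e' \<le> l'"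
      by (simp add: power_add mult.commute)
    then show ?thesis by (simp add: less_eq_div_iff_mult_less_eq)
  qed
  ultimately have "l div 2 ^ e \<noteq> l' div 2 ^ e'" by simp
  then have "int (l div 2 ^ e) \<noteq> int (l' div 2 ^ e')" by (metis of_nat_eq_iff)
  then show ?thesis
    unfolding zdiv_int of_nat_power of_nat_numeral e_def e'_def .
qed

text \<open>
  For \<open>m = n\<close> the index \<open>s\<close> in the definition of \<open>\<beta>\<^sub>l\<^sub>,\<^sub>l\<^sub>'\<close> and the level \<open>k\<close> are related by
  \<open>k = 1 + s - n\<close>: the ancestors of level \<open>k\<close> are then given by the leading \<open>s + 1\<close> digits.
\<close>

lemma gram_head:
  fixes \<psi> :: "'r::finite \<Rightarrow> real \<Rightarrow> complex"
  defines "K \<equiv> \<lambda>l n. int (bits l) - int n"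
  shows "(\<Sum>k\<in>{- int (max m n)<..min (K l n) (K l' m)}. gram_term \<psi> (K l n) (int l) (K l' m) (int l') k) =
    of_bool (m = n) * (of_real B * of_bool (l = l') - beta \<psi> B l l')"
    (is "sum ?g ?H = _")
proof (cases "m = n")
  case False
  have "?g k = 0" if "k \<in> ?H" for k
  proof (cases "n < m")
    case True
    then show ?thesis
      using gram_head_distinct[OF True, of k l l'] that by (simp add: gram_term_def K_def)
  next
    case F: False
    then have "m < n" using False by simp
    then show ?thesis
      using gram_head_distinct[OF \<open>m < n\<close>, of k l' l] that by (simp add: gram_term_def K_def)
  qed
  then show ?thesis using False by (simp add: sum.neutral)
next
  case m: True
  show ?thesis
  proof (cases "l = 0 \<or> l' = 0")
    case True
    then have "?H = {}" using m by (auto simp: K_def bits_def)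
    then show ?thesis
      using True by (auto simp: beta_def)
  next
    case False
    let ?p = "floor_log l" and ?p' = "floor_log l'"
    have bits: "bits l = Suc ?p" "bits l' = Suc ?p'" using False by (auto simp: bits_def)
    have "sum ?g ?H = (\<Sum>s = 0..min ?p ?p'. ?g (1 + int s - int n))"
      by (rule sum.reindex_bij_witness[where i = "\<lambda>s. 1 + int s - int n" and j = "\<lambda>k. nat (k + int n - 1)"])
         (use m in \<open>auto simp: K_def bits nat_le_iff\<close>)
    also have "\<dots> = (\<Sum>s = 0..min ?p ?p'. of_bool (l div 2 ^ (?p - s) = l' div 2 ^ (?p' - s)) *
      vec_inner (haar_vec \<psi> (low_index l' (?p' - s))) (haar_vec \<psi> (low_index l (?p - s))))"
    proof (rule sum.cong[OF refl])
      fix s assume s: "s \<in> {0..min ?p ?p'}"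
      have e: "nat (K l n - (1 + int s - int n)) = ?p - s" "nat (K l' m - (1 + int s - int n)) = ?p' - s"
        using s m by (auto simp: K_def bits)
      have le: "1 + int s - int n \<le> K l n" "1 + int s - int n \<le> K l' m"
        using s m by (auto simp: K_def bits)
      have div: "int l div 2 ^ j = int (l div 2 ^ j)" and mod: "nat (int l mod 2 ^ j) = l mod 2 ^ j" for l j
        by (simp_all add: zdiv_int nat_mod_distrib nat_power_eq)
      show "?g (1 + int s - int n) = of_bool (l div 2 ^ (?p - s) = l' div 2 ^ (?p' - s)) *
          vec_inner (haar_vec \<psi> (low_index l' (?p' - s))) (haar_vec \<psi> (low_index l (?p - s)))"
        using le by (simp only: gram_term_def e index_below_def div mod low_index_eq of_nat_eq_iff) simp
    qed
    also have "\<dots> = of_real B * of_bool (l = l') - beta \<psi> B l l'"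
      using False by (intro beta_eq_common_ancestors) auto
    finally show ?thesis using m by simp
  qed
qed

lemma gram_eq_iff_hardy_inner_eq:
  fixes \<psi> :: "'r::finite \<Rightarrow> real \<Rightarrow> complex"
  assumes \<psi>: "\<And>i. \<psi> i \<in> L2_unit"
  defines "K \<equiv> \<lambda>l n. int (bits l) - int n"
  shows "gram \<psi> (K l n) (int l) (K l' m) (int l') = of_real B * of_bool (K l n = K l' m \<and> int l = int l') \<longleftrightarrow>
    hardy_inner (\<lambda>\<omega>. \<omega> ^ m *s hardy_h \<psi> l' \<omega>) (\<lambda>\<omega>. \<omega> ^ n *s hardy_h \<psi> l \<omega>) =
      delta (int m - int n) * beta \<psi> B l l'"
proof -
  have "(K l n = K l' m \<and> int l = int l') \<longleftrightarrow> m = n \<and> l = l'"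
    by (auto simp: K_def)
  moreover have "gram \<psi> (K l n) (int l) (K l' m) (int l') =
      hardy_inner (\<lambda>\<omega>. \<omega> ^ m *s hardy_h \<psi> l' \<omega>) (\<lambda>\<omega>. \<omega> ^ n *s hardy_h \<psi> l \<omega>) +
      of_bool (m = n) * (of_real B * of_bool (l = l') - beta \<psi> B l l')"
    unfolding K_def gram_eq_hardy_inner_plus[of \<psi>, OF \<psi>] gram_head[where B = B] ..
  ultimately show ?thesis
    by (cases "m = n") (auto simp: delta_def algebra_simps)
qed

section \<open>Reduction to Haar functions on the right half-line\<close>

text \<open>Only differences of levels enter the Gram sum.\<close>

lemma gram_shift: "gram \<psi> (K + d) J (K' + d) J' = gram \<psi> K J K' J'"
  unfolding gram_def
proof (rule infsum_reindex_bij_witness[where i = "\<lambda>k. k + d" and j = "\<lambda>k. k - d"])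
  fix k
  have "nat (K - (k - d)) = nat (K + d - k)" "nat (K' - (k - d)) = nat (K' + d - k)"
    by (simp_all add: algebra_simps)
  then show "gram_term \<psi> K J K' J' (k - d) = gram_term \<psi> (K + d) J (K' + d) J' k"
    by (simp add: gram_term_def index_below_def le_diff_eq)
qed auto

definition haar_vec_tail :: "('r::finite \<Rightarrow> real \<Rightarrow> complex) \<Rightarrow> nat \<Rightarrow> real" where
  "haar_vec_tail \<psi> M = infsum (\<lambda>m. (norm (haar_vec \<psi> m))\<^sup>2) {M..}"

lemma haar_vec_tail_tendsto:
  assumes "\<And>i. \<psi> i \<in> L2_unit"
  shows "haar_vec_tail \<psi> \<longlonglongrightarrow> 0"
proof -
  let ?a = "\<lambda>m. (norm (haar_vec \<psi> m))\<^sup>2"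
  note summ = haar_vec_norm_summable[of \<psi>, OF assms]
  have "?a sums infsum ?a UNIV"
    by (intro has_sum_imp_sums has_sum_infsum summ)
  then have "(\<lambda>M. infsum ?a UNIV - (\<Sum>m<M. ?a m)) \<longlonglongrightarrow> infsum ?a UNIV - infsum ?a UNIV"
    unfolding sums_def by (intro tendsto_intros)
  moreover have "infsum ?a UNIV - (\<Sum>m<M. ?a m) = haar_vec_tail \<psi> M" for M
  proof -
    have "infsum ?a UNIV = infsum ?a ({..<M} \<union> {M..})"
      by (rule arg_cong[where f = "infsum ?a"]) auto
    also have "\<dots> = infsum ?a {..<M} + infsum ?a {M..}"
      by (rule infsum_Un_disjoint) (auto intro: summ)
    finally show ?thesis by (simp add: haar_vec_tail_def)
  qed
  ultimately show ?thesis by simp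
qed

text \<open>Distinct levels meet distinct members of the Haar basis, all of them with large index.\<close>

lemma index_below_tail:
  assumes \<psi>: "\<And>i. \<psi> i \<in> L2_unit" and "N + K \<ge> 0"
  shows "infsum (\<lambda>k. (norm (haar_vec \<psi> (index_below K J k)))\<^sup>2) {..< - N} \<le> haar_vec_tail \<psi> (nat (N + K))"
proof -
  let ?a = "\<lambda>m. (norm (haar_vec \<psi> m))\<^sup>2"
  note summ = haar_vec_norm_summable[of \<psi>, OF \<psi>]
  have inj: "inj_on (index_below K J) {..< - N}"
    using inj_on_index_below by (rule inj_on_subset) (use assms(2) in auto)
  have sub: "index_below K J ` {..< - N} \<subseteq> {nat (N + K)..}"
  proof safe
    fix k assume k: "k < - N"
    have "nat (N + K) \<le> nat (K - k)" using k assms(2) by auto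
    also have "\<dots> \<le> 2 ^ nat (K - k)" by (rule less_imp_le[OF less_exp])
    also have "\<dots> \<le> index_below K J k" by (simp add: index_below_def)
    finally show "index_below K J k \<ge> nat (N + K)" .
  qed
  have "infsum (?a \<circ> index_below K J) {..< - N} = infsum ?a (index_below K J ` {..< - N})"
    by (rule infsum_reindex[OF inj, symmetric])
  also have "\<dots> \<le> haar_vec_tail \<psi> (nat (N + K))"
    unfolding haar_vec_tail_def by (rule infsum_mono_neutral[OF summ summ]) (use sub in auto)
  finally show ?thesis by (simp add: o_def)
qed

lemma gram_far_tail:
  assumes \<psi>: "\<And>i. \<psi> i \<in> L2_unit" and "N + K \<ge> 0" "N + K' \<ge> 0"
  shows "cmod (infsum (gram_term \<psi> K J K' J') {..< - N}) \<le>
    (haar_vec_tail \<psi> (nat (N + K)) + haar_vec_tail \<psi> (nat (N + K'))) / 2"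
proof -
  let ?a = "\<lambda>k. (norm (haar_vec \<psi> (index_below K J k)))\<^sup>2"
  let ?a' = "\<lambda>k. (norm (haar_vec \<psi> (index_below K' J' k)))\<^sup>2"
  have a: "?a summable_on {..< - N}" "?a' summable_on {..< - N}"
    using assms(2,3) by (auto intro!: index_below_norm_summable[of \<psi>, OF \<psi>])
  then have sum: "((\<lambda>k. (?a k + ?a' k) / 2) has_sum ((infsum ?a {..< - N} + infsum ?a' {..< - N}) / 2)) {..< - N}"
    unfolding divide_inverse by (intro has_sum_cmult_left has_sum_add has_sum_infsum)
  have "cmod (infsum (gram_term \<psi> K J K' J') {..< - N}) \<le> (infsum ?a {..< - N} + infsum ?a' {..< - N}) / 2"
  proof (rule norm_infsum_le[OF has_sum_infsum sum])
    show "gram_term \<psi> K J K' J' summable_on {..< - N}"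
      by (rule gram_term_summable[of \<psi>, OF \<psi>])
    fix k assume "k \<in> {..< - N}"
    then show "cmod (gram_term \<psi> K J K' J' k) \<le> (?a k + ?a' k) / 2"
      using norm_gram_term_le[of \<psi> K J K' J' k] assms(2,3) by auto
  qed
  also have "\<dots> \<le> (haar_vec_tail \<psi> (nat (N + K)) + haar_vec_tail \<psi> (nat (N + K'))) / 2"
    using index_below_tail[of \<psi>, OF \<psi> assms(2), of J] index_below_tail[of \<psi>, OF \<psi> assms(3), of J']
    by (intro divide_right_mono add_mono) auto
  finally show ?thesis .
qed

text \<open>
  Translating both Haar functions by \<open>2 ^ N\<close> does not change the terms of the Gram sum at
  levels \<open>k \<ge> - N\<close>, and the other terms are small.
\<close>

lemma gram_translate_tendsto:
  assumes \<psi>: "\<And>i. \<psi> i \<in> L2_unit"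
  shows "(\<lambda>N. gram \<psi> K (J + 2 ^ nat (int N + K)) K' (J' + 2 ^ nat (int N + K'))) \<longlonglongrightarrow> gram \<psi> K J K' J'"
proof -
  let ?G = "\<lambda>N. gram \<psi> K (J + 2 ^ nat (int N + K)) K' (J' + 2 ^ nat (int N + K'))"
  let ?t = "\<lambda>N. haar_vec_tail \<psi> (nat (int N + K)) + haar_vec_tail \<psi> (nat (int N + K'))"
  have bound: "cmod (?G N - gram \<psi> K J K' J') \<le> ?t N" if N: "int N + K \<ge> 0" "int N + K' \<ge> 0" for N
  proof -
    let ?g = "gram_term \<psi> K J K' J'"
    let ?gN = "gram_term \<psi> K (J + 2 ^ nat (int N + K)) K' (J' + 2 ^ nat (int N + K'))"
    have split: "infsum (gram_term \<psi> K J K' J') UNIV =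
        infsum (gram_term \<psi> K J K' J') {- int N..} + infsum (gram_term \<psi> K J K' J') {..< - int N}" for J J'
    proof -
      have "infsum (gram_term \<psi> K J K' J') UNIV = infsum (gram_term \<psi> K J K' J') ({- int N..} \<union> {..< - int N})"
        by (rule arg_cong[where f = "infsum _"]) auto
      also have "\<dots> = infsum (gram_term \<psi> K J K' J') {- int N..} + infsum (gram_term \<psi> K J K' J') {..< - int N}"
        by (rule infsum_Un_disjoint) (auto intro: gram_term_summable[of \<psi>, OF \<psi>])
      finally show ?thesis .
    qed
    have same: "?gN k = ?g k" if k: "k \<in> {- int N..}" for k
    proof -
      have div_mod: "(J + 2 ^ nat (int N + K)) div 2 ^ nat (K - k) = J div 2 ^ nat (K - k) + 2 ^ nat (int N + k)"
        "(J + 2 ^ nat (int N + K)) mod 2 ^ nat (K - k) = J mod 2 ^ nat (K - k)" if "k \<le> K" for K J :: int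
      proof -
        have "nat (int N + K) = nat (int N + k) + nat (K - k)"
          using that k by (simp flip: nat_add_distrib)
        then have "(2::int) ^ nat (int N + K) = 2 ^ nat (int N + k) * 2 ^ nat (K - k)"
          by (simp only: power_add)
        then show "(J + 2 ^ nat (int N + K)) div 2 ^ nat (K - k) = J div 2 ^ nat (K - k) + 2 ^ nat (int N + k)"
          "(J + 2 ^ nat (int N + K)) mod 2 ^ nat (K - k) = J mod 2 ^ nat (K - k)"
          by simp_all
      qed
      show ?thesis
        by (cases "k \<le> K \<and> k \<le> K'") (auto simp: gram_term_def index_below_def div_mod)
    qed
    have "?G N - gram \<psi> K J K' J' = infsum ?gN {..< - int N} - infsum ?g {..< - int N}"
      unfolding gram_def split using infsum_cong[of "{- int N..}", OF same] by simp
    also have "cmod \<dots> \<le> ?t N"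
      by (rule order_trans[OF norm_triangle_ineq4 order_trans[OF add_mono]],
          (rule gram_far_tail[of \<psi>, OF \<psi> N])+) simp
    finally show ?thesis .
  qed
  have lim: "(\<lambda>N. haar_vec_tail \<psi> (nat (int N + K))) \<longlonglongrightarrow> 0" for K
  proof (rule filterlim_compose[OF haar_vec_tail_tendsto[of \<psi>, OF \<psi>]])
    show "filterlim (\<lambda>N. nat (int N + K)) at_top sequentially"
      unfolding filterlim_at_top
    proof
      fix Z
      show "eventually (\<lambda>N. Z \<le> nat (int N + K)) sequentially"
        using eventually_ge_at_top[of "Z + nat \<bar>K\<bar>"] by eventually_elim linarith
    qed
  qed
  have "?t \<longlonglongrightarrow> 0"
    using tendsto_add[OF lim[of K] lim[of K']] by simp
  moreover have "eventually (\<lambda>N. cmod (?G N - gram \<psi> K J K' J') \<le> ?t N) sequentially"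
    using eventually_ge_at_top[of "nat \<bar>K\<bar> + nat \<bar>K'\<bar>"] by eventually_elim (rule bound; linarith)
  ultimately have "(\<lambda>N. ?G N - gram \<psi> K J K' J') \<longlonglongrightarrow> 0"
    by (rule Lim_null_comparison[rotated])
  then show ?thesis by (simp add: LIM_zero_iff)
qed

text \<open>
  Shifting the levels makes the offsets \<open>n\<close> and \<open>m\<close> nonnegative, and a translation to the right
  makes the positions nonnegative.
\<close>

lemma gram_eq_if_hardy_inner_eq:
  fixes \<psi> :: "'r::finite \<Rightarrow> real \<Rightarrow> complex"
  assumes \<psi>: "\<And>i. \<psi> i \<in> L2_unit"
    and hardy: "\<And>l l' m n. hardy_inner (\<lambda>\<omega>. \<omega> ^ m *s hardy_h \<psi> l' \<omega>) (\<lambda>\<omega>. \<omega> ^ n *s hardy_h \<psi> l \<omega>) =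
       delta (int m - int n) * beta \<psi> B l l'"
  shows "gram \<psi> K J K' J' = of_real B * of_bool (K = K' \<and> J = J')"
proof -
  have nonneg: "gram \<psi> K J K' J' = of_real B * of_bool (K = K' \<and> J = J')" if "J \<ge> 0" "J' \<ge> 0" for K J K' J'
  proof -
    define l where "l = nat J"
    define l' where "l' = nat J'"
    have l: "J = int l" "J' = int l'" using that by (auto simp: l_def l'_def)
    (* The largest shift for which both n and m below are nonnegative. *)
    define d where "d = min (int (bits l) - K) (int (bits l') - K')"
    define n where "n = nat (int (bits l) - (K + d))"
    define m where "m = nat (int (bits l') - (K' + d))"
    have K: "K + d = int (bits l) - int n" "K' + d = int (bits l') - int m"
      by (auto simp: n_def m_def d_def)
    have "gram \<psi> K J K' J' = gram \<psi> (int (bits l) - int n) (int l) (int (bits l') - int m) (int l')"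
      using gram_shift[of \<psi> K d J K' J'] by (simp only: K l)
    also have "\<dots> = of_real B * of_bool (int (bits l) - int n = int (bits l') - int m \<and> int l = int l')"
      using gram_eq_iff_hardy_inner_eq[of \<psi>, OF \<psi>] hardy by blast
    also have "int (bits l) - int n = int (bits l') - int m \<longleftrightarrow> K = K'"
      unfolding K[symmetric] by simp
    finally show ?thesis by (simp only: l)
  qed
  have "(\<lambda>N. gram \<psi> K (J + 2 ^ nat (int N + K)) K' (J' + 2 ^ nat (int N + K'))) \<longlonglongrightarrow>
      of_real B * of_bool (K = K' \<and> J = J')"
  proof (rule tendsto_eventually)
    show "eventually (\<lambda>N. gram \<psi> K (J + 2 ^ nat (int N + K)) K' (J' + 2 ^ nat (int N + K')) =
        of_real B * of_bool (K = K' \<and> J = J')) sequentially"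
      using eventually_ge_at_top[of "nat \<bar>K\<bar> + nat \<bar>K'\<bar> + nat \<bar>J\<bar> + nat \<bar>J'\<bar>"]
    proof eventually_elim
      case (elim N)
      have big: "x + 2 ^ nat (int N + y) \<ge> 0" if "\<bar>x\<bar> \<le> int N + y" for x y :: int
      proof -
        have "int (nat (int N + y)) < int (2 ^ nat (int N + y))"
          using less_exp[of "nat (int N + y)"] by (simp only: of_nat_less_iff)
        moreover have "int (nat (int N + y)) = int N + y" using that by simp
        ultimately have "int N + y < 2 ^ nat (int N + y)" by (simp only: of_nat_power of_nat_numeral)
        then show ?thesis using that by linarith
      qed
      have "gram \<psi> K (J + 2 ^ nat (int N + K)) K' (J' + 2 ^ nat (int N + K')) =
          of_real B * of_bool (K = K' \<and> J + 2 ^ nat (int N + K) = J' + 2 ^ nat (int N + K'))"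
        using elim by (intro nonneg big) linarith+
      then show ?case by auto
    qed
  qed
  with gram_translate_tendsto[of \<psi>, OF \<psi>] show ?thesis
    by (rule LIMSEQ_unique)
qed

section \<open>The characterization of tight wavelet frames\<close>

theorem proposition3p5:
  fixes \<psi> :: "'r::finite \<Rightarrow> real \<Rightarrow> complex" and B :: real
  assumes "B > 0"
    and "\<And>i. \<psi> i \<in> L2_unit"
  shows "tight_frame \<psi> B \<longleftrightarrow>
    haar_vec \<psi> 0 = 0 \<and>
    (\<forall>l l' m n :: nat.
       hardy_inner (\<lambda>\<omega>. \<omega> ^ m *s hardy_h \<psi> l' \<omega>) (\<lambda>\<omega>. \<omega> ^ n *s hardy_h \<psi> l \<omega>) =
       delta (int m - int n) * beta \<psi> B l l')"
  using gram_eq_iff_hardy_inner_eq[of \<psi>, OF assms(2)] gram_eq_if_hardy_inner_eq[of \<psi>, OF assms(2)]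
  unfolding tight_frame_iff_gram[of \<psi>, OF assms(2,1)]
  by blast

end
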